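(* Let $p$ be an odd prime, let $\nu,k,s$ be positive integers, and let $A=(\mathbb{Z}_{2^k})^s$. Let $r'$ be the largest integer with $0\le r'\le k$ such that $2^{r'}\mid (p^\nu+1)$. Let $r_I$ be the number of $p^\nu$-cyclotomic classes of $A$ of type $I$ and $2r_{II}$ the number of those of type $II$. Then $$r_I=2^s+\frac{2^{r's}-2^s}{2}\quad\text{and}\quad r_{II}=\sum_{i=r'+1}^{k}\frac{2^{is}-2^{(i-1)s}}{2\,\mathrm{ord}_{2^i}(p^\nu)},$$ and the number of Euclidean complementary dual abelian codes in $\mathbb{F}_{p^\nu}[(\mathbb{Z}_{2^k})^s]$ is $2^{r_I+r_{II}}$.
   Context: For a finite abelian group $G$ (written additively), an abelian code in $\mathbb{F}_{p^\nu}[G]$ is an ideal of this group algebra. For $u=\sum_g u_gY^g$, $v=\sum_g v_gY^g$, $\langle u,v\rangle_{\rm E}=\sum_g u_gv_g$; $C^{\perp_{\rm E}}=\{v : \langle c,v\rangle_{\rm E}=0\ \forall c\in C\}$; $C$ is Euclidean complementary dual if $C\cap C^{\perp_{\rm E}}=\{0\}$. For $a\in A$, $S_{p^\nu}(a)=\{p^{\nu i}\cdot a : i\ge 0\}$ is the $p^\nu$-cyclotomic class of $a$ (these classes partition $A$); it is of type $I$ if $S_{p^\nu}(a)=S_{p^\nu}(-a)$ and of type $II$ otherwise; type $II$ classes come in pairs $S_{p^\nu}(a)\ne S_{p^\nu}(-a)$. $\mathrm{ord}_m(x)$ denotes the multiplicative order of $x$ modulo $m$. *)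

theory Defs
  imports "HOL-Algebra.Algebra" "HOL-Number_Theory.Number_Theory"
begin

text \<open>
  The group algebra \<open>K[G]\<close> of a finite group \<open>G\<close>: an element \<open>u = \<Sum>g. u\<^sub>g Y\<^sup>g\<close> is its coefficient
  function, extensional on \<open>carrier G\<close>, and multiplication is convolution. The group law of \<open>G\<close>
  is the monoid operation of the record, also for the additively written groups used here, so
  \<open>inv\<^bsub>G\<^esub> h \<otimes>\<^bsub>G\<^esub> g\<close> is \<open>g - h\<close>, \<open>\<one>\<^bsub>G\<^esub>\<close> is \<open>0\<close>, and \<open>a [^]\<^bsub>G\<^esub> n\<close> is \<open>n \<cdot> a\<close>.
\<close>

definition group_algebra ::
  "('a, 'b) ring_scheme \<Rightarrow> ('g, 'h) monoid_scheme \<Rightarrow> ('g \<Rightarrow> 'a) ring" where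
  "group_algebra K G =
    \<lparr>carrier = carrier G \<rightarrow>\<^sub>E carrier K,
     monoid.mult = (\<lambda>u v. \<lambda>g\<in>carrier G.
       (\<Oplus>\<^bsub>K\<^esub>h\<in>carrier G. u h \<otimes>\<^bsub>K\<^esub> v (inv\<^bsub>G\<^esub> h \<otimes>\<^bsub>G\<^esub> g))),
     one = (\<lambda>g\<in>carrier G. if g = \<one>\<^bsub>G\<^esub> then \<one>\<^bsub>K\<^esub> else \<zero>\<^bsub>K\<^esub>),
     ring.zero = (\<lambda>g\<in>carrier G. \<zero>\<^bsub>K\<^esub>),
     ring.add = (\<lambda>u v. \<lambda>g\<in>carrier G. u g \<oplus>\<^bsub>K\<^esub> v g)\<rparr>"

definition abelian_code ::
  "('a, 'b) ring_scheme \<Rightarrow> ('g, 'h) monoid_scheme \<Rightarrow> ('g \<Rightarrow> 'a) set \<Rightarrow> bool" where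
  "abelian_code K G C \<longleftrightarrow> ideal C (group_algebra K G)"

definition euclidean_inner ::
  "('a, 'b) ring_scheme \<Rightarrow> ('g, 'h) monoid_scheme \<Rightarrow> ('g \<Rightarrow> 'a) \<Rightarrow> ('g \<Rightarrow> 'a) \<Rightarrow> 'a" where
  "euclidean_inner K G u v = (\<Oplus>\<^bsub>K\<^esub>g\<in>carrier G. u g \<otimes>\<^bsub>K\<^esub> v g)"

definition euclidean_dual ::
  "('a, 'b) ring_scheme \<Rightarrow> ('g, 'h) monoid_scheme \<Rightarrow> ('g \<Rightarrow> 'a) set \<Rightarrow> ('g \<Rightarrow> 'a) set" where
  "euclidean_dual K G C =
    {v \<in> carrier (group_algebra K G). \<forall>c\<in>C. euclidean_inner K G c v = \<zero>\<^bsub>K\<^esub>}"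

definition euclidean_complementary_dual ::
  "('a, 'b) ring_scheme \<Rightarrow> ('g, 'h) monoid_scheme \<Rightarrow> ('g \<Rightarrow> 'a) set \<Rightarrow> bool" where
  "euclidean_complementary_dual K G C \<longleftrightarrow>
    C \<inter> euclidean_dual K G C = {\<zero>\<^bsub>group_algebra K G\<^esub>}"

definition cyclotomic_class :: "('g, 'h) monoid_scheme \<Rightarrow> nat \<Rightarrow> 'g \<Rightarrow> 'g set" where
  "cyclotomic_class G q a = {a [^]\<^bsub>G\<^esub> (q ^ i) | i :: nat. True}"

definition type_I_classes :: "('g, 'h) monoid_scheme \<Rightarrow> nat \<Rightarrow> 'g set set" where
  "type_I_classes G q =
    {cyclotomic_class G q a | a. a \<in> carrier G \<and>
       cyclotomic_class G q a = cyclotomic_class G q (inv\<^bsub>G\<^esub> a)}"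

definition type_II_classes :: "('g, 'h) monoid_scheme \<Rightarrow> nat \<Rightarrow> 'g set set" where
  "type_II_classes G q =
    {cyclotomic_class G q a | a. a \<in> carrier G \<and>
       cyclotomic_class G q a \<noteq> cyclotomic_class G q (inv\<^bsub>G\<^esub> a)}"

text \<open>The group \<open>(\<int>/m\<int>)\<^sup>s\<close>.\<close>

definition int_mod_power :: "nat \<Rightarrow> nat \<Rightarrow> (nat \<Rightarrow> int) monoid" where
  "int_mod_power m s = product_group {..<s} (\<lambda>_. integer_mod_group m)"

end

(* The Frobenius map u -> u^q of R = K[G] permutes coefficients along g -> q g, so some power of it
   is the identity. Hence every ideal of R is generated by exactly one idempotent. The inner product
   of u and v is the coefficient at 0 of u times flip v, where flip is induced by g -> -g; the code
   generated by the idempotent e is therefore complementary dual iff flip e = e. These idempotents are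
   the idempotents of B = {u. u^q = u and flip u = u}, a ring with q^n elements where n is the number
   of sets S(a) \<union> S(-a). Splitting B along idempotents shows that a K-algebra satisfying x^q = x
   with q^n elements has 2^n idempotents.

   Numbers of classes are evaluated as sums of 1 / card S(a) over group elements a, sorted by their
   order 2^i; an element is of type I iff its order divides q + 1. *)

theory Submission
  imports Defs
begin


section \<open>Finite commutative rings\<close>

text \<open>Characters of the group and the decomposition of the group algebra into extension fields
  are avoided: matching primitive idempotents with cyclotomic classes would need roots of unity
  outside K. Only the number of idempotents matters, and it can be read off the cardinality of a
  fixed ring, which is visible on coefficients: a function constant on the sets S(a) \<union> S(-a)
  chooses one scalar per set. The exponent n equals r_I + r_II because such a set is a single class
  for type I and the union of a pair for type II. Oddness of p enters twice: it makes q invertible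
  modulo the group order 2^(ks), and it forces even powers of q to be 1 modulo 4, so that -1 is a
  power of q modulo 2^i only if q itself is -1 modulo 2^i.\<close>

lemma (in cring) binomial:
  assumes x: "x \<in> carrier R" and y: "y \<in> carrier R"
  shows "(x \<oplus> y) [^] (n::nat) = (\<Oplus>k\<in>{..n}. add_pow R (n choose k) (x [^] k \<otimes> y [^] (n - k)))"
proof (induction n)
  case 0
  show ?case by simp
next
  case (Suc n)
  let ?t = "\<lambda>m k. x [^] k \<otimes> y [^] (m - k)"
  have "(x \<oplus> y) [^] Suc n = (\<Oplus>k\<in>{..n}. add_pow R (n choose k) (?t n k)) \<otimes> x \<oplus> (\<Oplus>k\<in>{..n}. add_pow R (n choose k) (?t n k)) \<otimes> y"
    using x y by (simp add: Suc r_distr)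
  also have "(\<Oplus>k\<in>{..n}. add_pow R (n choose k) (?t n k)) \<otimes> x = (\<Oplus>k\<in>{..n}. add_pow R (n choose k) (?t (Suc n) (Suc k)))"
  proof -
    have "x [^] k \<otimes> y [^] (n - k) \<otimes> x = ?t (Suc n) (Suc k)" for k
      using x y by (simp add: m_ac)
    then show ?thesis using x y by (auto simp: finsum_ldistr add_pow_ldistr intro!: finsum_cong')
  qed
  \<comment> \<open>Index shift; the coefficient 0 at \<open>k = 0\<close> lets both sums run over
    \<open>{..Suc n}\<close>, where Pascal's rule adds them termwise.\<close>
  also have "\<dots> = (\<Oplus>k\<in>{..Suc n}. add_pow R (if k = 0 then 0 else n choose (k - 1)) (?t (Suc n) k))"
    using x y by (subst finsum_Suc2) auto
  also have "(\<Oplus>k\<in>{..n}. add_pow R (n choose k) (?t n k)) \<otimes> y = (\<Oplus>k\<in>{..n}. add_pow R (n choose k) (?t (Suc n) k))"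
    using x y by (auto simp: finsum_ldistr add_pow_ldistr m_assoc Suc_diff_le intro!: finsum_cong')
  also have "\<dots> = (\<Oplus>k\<in>{..Suc n}. add_pow R (n choose k) (?t (Suc n) k))"
    using x y by (subst finsum_Suc) (auto simp: binomial_eq_0)
  also have "(\<Oplus>k\<in>{..Suc n}. add_pow R (if k = 0 then 0 else n choose (k - 1)) (?t (Suc n) k)) \<oplus> \<dots>
      = (\<Oplus>k\<in>{..Suc n}. add_pow R (if k = 0 then 0 else n choose (k - 1)) (?t (Suc n) k) \<oplus> add_pow R (n choose k) (?t (Suc n) k))"
    using x y by (subst finsum_addf) auto
  also have "\<dots> = (\<Oplus>k\<in>{..Suc n}. add_pow R (Suc n choose k) (?t (Suc n) k))"
    using x y
    by (intro finsum_cong') (auto simp: add.nat_pow_mult choose_reduce_nat add.commute)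
  finally show ?case .
qed

text \<open>The inner binomial coefficients are divisible by \<open>p\<close>, and a multiple of
  \<open>p\<close> kills every element because it already kills the unit.\<close>

lemma (in cring) freshmans_dream:
  fixes p :: nat
  assumes p: "Factorial_Ring.prime p" and char: "add_pow R p \<one> = \<zero>"
    and x: "x \<in> carrier R" and y: "y \<in> carrier R"
  shows "(x \<oplus> y) [^] p = x [^] p \<oplus> y [^] p"
proof -
  have p0: "p \<noteq> 0" using p by auto
  have kill: "add_pow R m z = \<zero>" if "p dvd m" "z \<in> carrier R" for m z
  proof -
    from that obtain l where "m = p * l" by blast
    then have "add_pow R m \<one> = \<zero>" using char by (simp add: add.nat_pow_pow[symmetric])
    then show ?thesis using add_pow_ldistr[of \<one> z m] that by simp
  qed
  obtain p' where p': "p = Suc p'" using p0 by (cases p) auto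
  let ?t = "\<lambda>k. add_pow R (p choose k) (x [^] k \<otimes> y [^] (p - k))"
  have "(x \<oplus> y) [^] p = (\<Oplus>k\<in>{..p}. ?t k)" by (rule binomial[OF x y])
  also have "\<dots> = (\<Oplus>k\<in>{0, p}. ?t k)"
  proof (rule add.finprod_mono_neutral_cong_right)
    show "?t i = \<zero>" if "i \<in> {..p} - {0, p}" for i
      using that x y p0 by (auto intro!: kill dvd_choose_prime p)
  qed (use x y in auto)
  also have "\<dots> = x [^] p \<oplus> y [^] p"
    using x y p0 by (simp add: add.m_comm)
  finally show ?thesis .
qed

lemma (in cring) freshmans_dream_power:
  fixes p \<nu> :: nat
  assumes p: "Factorial_Ring.prime p" and char: "add_pow R p \<one> = \<zero>"
    and x: "x \<in> carrier R" and y: "y \<in> carrier R"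
  shows "(x \<oplus> y) [^] (p ^ \<nu>) = x [^] (p ^ \<nu>) \<oplus> y [^] (p ^ \<nu>)"
proof (induction \<nu>)
  case 0
  show ?case using x y by simp
next
  case (Suc \<nu>)
  have pw: "z [^] (p ^ Suc \<nu>) = (z [^] (p ^ \<nu>)) [^] p" if "z \<in> carrier R" for z
    using that by (simp add: nat_pow_pow mult.commute)
  show ?case using x y by (simp add: pw Suc freshmans_dream[OF p char] del: power_Suc)
qed

lemma (in cring) freshmans_dream_finsum:
  fixes p \<nu> :: nat
  assumes p: "Factorial_Ring.prime p" and char: "add_pow R p \<one> = \<zero>"
    and "finite I" and "f \<in> I \<rightarrow> carrier R"
  shows "(\<Oplus>i\<in>I. f i) [^] (p ^ \<nu>) = (\<Oplus>i\<in>I. f i [^] (p ^ \<nu>))"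
  using assms(3,4)
proof (induction I)
  case empty
  show ?case using p by (simp add: prime_gt_0_nat nat_pow_zero)
next
  case (insert i I)
  then show ?case
    by (subst finsum_insert; (subst finsum_insert)?)
       (auto simp: freshmans_dream_power[OF p char] Pi_iff)
qed

lemma (in field) finite_field_pow_card:
  assumes fin: "finite (carrier R)" and x: "x \<in> carrier R"
  shows "x [^] card (carrier R) = x"
proof (cases "x = \<zero>")
  case True
  \<comment> \<open>The exponent has to be positive here, since the 0-th power of zero is the
    unit.\<close>
  then have "card (carrier R) \<noteq> 0" using fin x by auto
  then show ?thesis using True nat_pow_zero by simp
next
  case False
  interpret M: group "Multiplicative_Group.mult_of R" by (rule field_mult_group)
  have c: "card (carrier R) = Suc (order (Multiplicative_Group.mult_of R))"
    using fin card.remove[OF fin zero_closed] by (simp add: order_def)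
  have "x [^] order (Multiplicative_Group.mult_of R) = \<one>"
    using M.pow_order_eq_1[of x] x False by (simp add: Multiplicative_Group.nat_pow_mult_of)
  then show ?thesis using x by (simp add: c)
qed

text \<open>Lagrange in the additive group only gives that \<open>p ^ \<nu>\<close> times the unit
  is zero. This element is the \<open>\<nu>\<close>-th power of \<open>p\<close> times the unit, and
  a field has no nonzero nilpotents.\<close>

lemma (in field) finite_field_char:
  fixes p \<nu> :: nat
  assumes fin: "finite (carrier R)" and card: "card (carrier R) = p ^ \<nu>"
  shows "add_pow R p \<one> = \<zero>"
proof -
  have "add_pow R (p ^ \<nu>) \<one> = \<zero>"
    using add.pow_order_eq_1[of \<one>] card by (simp add: order_def)
  moreover have "add_pow R (p ^ n) \<one> = (add_pow R p \<one>) [^] n" for n :: nat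
  proof (induction n)
    case (Suc n)
    have "add_pow R (p ^ Suc n) \<one> = add_pow R (p ^ n) (add_pow R p \<one>)" by (simp add: add.nat_pow_pow mult.commute)
    also have "\<dots> = (add_pow R (p ^ n) \<one>) \<otimes> (add_pow R p \<one>)" by (subst add_pow_ldistr) auto
    finally show ?case by (simp add: Suc)
  qed simp
  ultimately have "(add_pow R p \<one>) [^] \<nu> = \<zero>" by simp
  moreover have "x = \<zero>" if "x \<in> carrier R" "x [^] n = \<zero>" for x and n :: nat
    using that(2) by (induction n) (use that(1) integral in auto)
  ultimately show ?thesis by auto
qed


section \<open>Corner rings and the number of idempotents\<close>

text \<open>The ideal eR as a ring with unit e. For an idempotent e its elements are exactly those
  fixed by e, which turns membership into an equation.\<close>

definition corner :: "('r, 'm) ring_scheme \<Rightarrow> 'r \<Rightarrow> ('r, 'm) ring_scheme" where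
  "corner R e = R\<lparr>carrier := {x \<in> carrier R. e \<otimes>\<^bsub>R\<^esub> x = x}, one := e\<rparr>"

lemma corner_simps [simp]:
  "carrier (corner R e) = {x \<in> carrier R. e \<otimes>\<^bsub>R\<^esub> x = x}"
  "\<one>\<^bsub>corner R e\<^esub> = e" "\<zero>\<^bsub>corner R e\<^esub> = \<zero>\<^bsub>R\<^esub>"
  "monoid.mult (corner R e) = monoid.mult R" "ring.add (corner R e) = ring.add R"
  by (simp_all add: corner_def)

lemma (in cring) corner_cring:
  assumes e: "e \<in> carrier R" "e \<otimes> e = e"
  shows "cring (corner R e)"
proof (rule cringI)
  show "abelian_group (corner R e)"
  proof (rule abelian_groupI)
    fix x assume x: "x \<in> carrier (corner R e)"
    then show "\<exists>y\<in>carrier (corner R e). y \<oplus>\<^bsub>corner R e\<^esub> x = \<zero>\<^bsub>corner R e\<^esub>"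
      using e by (intro bexI[of _ "\<ominus> x"]) (auto simp: l_neg r_minus)
  qed (use e in \<open>auto simp: r_distr a_ac\<close>)
  show "comm_monoid (corner R e)"
  proof (rule comm_monoidI)
    fix x y assume "x \<in> carrier (corner R e)" "y \<in> carrier (corner R e)"
    then show "x \<otimes>\<^bsub>corner R e\<^esub> y \<in> carrier (corner R e)"
      using e by (simp add: m_assoc[symmetric])
    show "x \<otimes>\<^bsub>corner R e\<^esub> y = y \<otimes>\<^bsub>corner R e\<^esub> x"
      using m_comm \<open>x \<in> _\<close> \<open>y \<in> _\<close> by simp
  qed (use e in \<open>auto simp: m_assoc\<close>)
qed (use e in \<open>auto simp: l_distr\<close>)

text \<open>Exponent 0 is excluded: the empty product is e in the corner but the unit of R in
  R.\<close>

lemma (in cring) corner_pow: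
  assumes e: "e \<in> carrier R" "e \<otimes> e = e" and x: "x \<in> carrier (corner R e)" and n: "n > 0"
  shows "x [^]\<^bsub>corner R e\<^esub> (n::nat) = x [^] n"
  using n
proof (induction n)
  case (Suc n)
  then show ?case using x by (cases "n = 0") auto
qed simp

text \<open>Passing to a corner keeps the K-algebra structure, but the structure map must be
  multiplied by e in order to send the unit of K to the unit of the corner.\<close>

lemma (in cring) corner_ring_hom:
  assumes e: "e \<in> carrier R" "e \<otimes> e = e" and h: "\<phi> \<in> ring_hom K R"
  shows "(\<lambda>a. e \<otimes> \<phi> a) \<in> ring_hom K (corner R e)"
proof (rule ring_hom_memI)
  fix a b assume ab: "a \<in> carrier K" "b \<in> carrier K"
  then have c: "\<phi> a \<in> carrier R" "\<phi> b \<in> carrier R" using h by (auto simp: ring_hom_def)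
  have ee: "e \<otimes> (e \<otimes> z) = e \<otimes> z" if "z \<in> carrier R" for z
    using e that by (simp add: m_assoc[symmetric])
  show "e \<otimes> \<phi> a \<in> carrier (corner R e)" using e c ee by auto
  show "e \<otimes> \<phi> (a \<otimes>\<^bsub>K\<^esub> b) = (e \<otimes> \<phi> a) \<otimes>\<^bsub>corner R e\<^esub> (e \<otimes> \<phi> b)"
  proof -
    have "(e \<otimes> \<phi> a) \<otimes> (e \<otimes> \<phi> b) = e \<otimes> (e \<otimes> (\<phi> a \<otimes> \<phi> b))" using e c by (simp add: m_ac)
    then show ?thesis using c ee by (simp add: ring_hom_mult[OF h ab])
  qed
  show "e \<otimes> \<phi> (a \<oplus>\<^bsub>K\<^esub> b) = (e \<otimes> \<phi> a) \<oplus>\<^bsub>corner R e\<^esub> (e \<otimes> \<phi> b)"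
    using e c by (simp add: ring_hom_add[OF h ab] r_distr)
qed (use e ring_hom_one[OF h] in auto)

text \<open>Peirce decomposition: R is the product of fR and (1 - f)R, with addition as the inverse
  map. Idempotents correspond to pairs of idempotents because products across the two corners
  vanish.\<close>

lemma (in cring) corner_decomposition:
  assumes f: "f \<in> carrier R" "f \<otimes> f = f"
  defines "g \<equiv> \<one> \<ominus> f"
  shows "g \<in> carrier R" and "g \<otimes> g = g"
    and "bij_betw (\<lambda>x. (f \<otimes> x, g \<otimes> x)) (carrier R) (carrier (corner R f) \<times> carrier (corner R g))"
    and "bij_betw (\<lambda>x. (f \<otimes> x, g \<otimes> x)) {x \<in> carrier R. x \<otimes> x = x}
           ({x \<in> carrier (corner R f). x \<otimes> x = x} \<times> {x \<in> carrier (corner R g). x \<otimes> x = x})"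
proof -
  let ?h = "\<lambda>x. (f \<otimes> x, g \<otimes> x)"
  show g: "g \<in> carrier R" using f by (simp add: g_def)
  have fg: "f \<otimes> g = \<zero>" using f by (simp add: g_def minus_eq r_distr r_minus r_neg)
  show gg: "g \<otimes> g = g" using f by (simp add: g_def minus_eq r_distr l_distr l_minus r_minus r_neg)
  have gf: "g \<otimes> f = \<zero>" using fg f g by (simp add: m_comm)
  have s: "f \<oplus> g = \<one>" using f by (simp add: g_def minus_eq a_lcomm[of f \<one>] r_neg)
  have dec: "f \<otimes> x \<oplus> g \<otimes> x = x" if "x \<in> carrier R" for x
    using that f g s by (simp add: l_distr[symmetric])
  have inv1: "f \<otimes> (a \<oplus> b) = a" "g \<otimes> (a \<oplus> b) = b"
    if "a \<in> carrier (corner R f)" "b \<in> carrier (corner R g)" for a b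
  proof -
    have ab: "a \<in> carrier R" "b \<in> carrier R" "f \<otimes> a = a" "g \<otimes> b = b" using that by auto
    have "f \<otimes> b = \<zero>" "g \<otimes> a = \<zero>"
      using ab f g fg gf by (metis m_assoc l_null)+
    then show "f \<otimes> (a \<oplus> b) = a" "g \<otimes> (a \<oplus> b) = b" using ab f g by (simp_all add: r_distr)
  qed
  have idem: "h \<otimes> x \<in> carrier (corner R h)" "(h \<otimes> x) \<otimes> (h \<otimes> y) = h \<otimes> (x \<otimes> y)"
    if "h \<in> carrier R" "h \<otimes> h = h" "x \<in> carrier R" "y \<in> carrier R" for h x y
  proof -
    have *: "h \<otimes> (h \<otimes> z) = h \<otimes> z" if "z \<in> carrier R" for z
      using that \<open>h \<in> carrier R\<close> \<open>h \<otimes> h = h\<close> by (simp add: m_assoc[symmetric])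
    show "h \<otimes> x \<in> carrier (corner R h)" using that * by simp
    show "(h \<otimes> x) \<otimes> (h \<otimes> y) = h \<otimes> (x \<otimes> y)"
      using that *[of "x \<otimes> y"] by (simp add: m_ac)
  qed
  have sqs: "(a \<oplus> b) \<otimes> (a \<oplus> b) = a \<oplus> b"
    if "a \<in> carrier (corner R f)" "b \<in> carrier (corner R g)" "a \<otimes> a = a" "b \<otimes> b = b" for a b
  proof -
    have ab: "a \<in> carrier R" "b \<in> carrier R" "f \<otimes> a = a" "g \<otimes> b = b" using that by auto
    \<comment> \<open>Since \<open>a\<close> absorbs \<open>f\<close> and \<open>b\<close> absorbs
      \<open>g\<close>, the product absorbs \<open>f \<otimes> g\<close>, which is zero.\<close>
    have "a \<otimes> b = (f \<otimes> g) \<otimes> (a \<otimes> b)" using ab f g by (metis m_assoc m_comm m_closed)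
    then have "a \<otimes> b = \<zero>" using ab fg by simp
    then show ?thesis using ab that by (simp add: l_distr r_distr m_comm)
  qed
  show bij: "bij_betw ?h (carrier R) (carrier (corner R f) \<times> carrier (corner R g))"
    by (rule bij_betw_byWitness[where f' = "\<lambda>(a, b). a \<oplus> b"])
       (use dec inv1 idem(1)[OF f] idem(1)[OF g gg] in auto)
  show "bij_betw ?h {x \<in> carrier R. x \<otimes> x = x}
           ({x \<in> carrier (corner R f). x \<otimes> x = x} \<times> {x \<in> carrier (corner R g). x \<otimes> x = x})"
    by (rule bij_betw_byWitness[where f' = "\<lambda>(a, b). a \<oplus> b"])
       (use dec inv1 idem(1)[OF f] idem(1)[OF g gg] idem(2)[OF f] idem(2)[OF g gg] sqs in auto)
qed

text \<open>With q the size of K, x^q = x makes x^(q-1) an idempotent that fixes x, hence the unit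
  as soon as x is nonzero. So R is a domain whose nonzero elements are roots of X^(q-1) - 1, which
  bounds its size from above; the embedding of K bounds it from below.\<close>

lemma (in cring) no_idempotents_card:
  assumes fin: "finite (carrier R)" and K: "field K" "finite (carrier K)"
    and h: "\<phi> \<in> ring_hom K R"
    and pow: "\<And>x. x \<in> carrier R \<Longrightarrow> x [^] card (carrier K) = x"
    and nz: "\<one> \<noteq> \<zero>"
    and idem: "\<And>e. e \<in> carrier R \<Longrightarrow> e \<otimes> e = e \<Longrightarrow> e = \<zero> \<or> e = \<one>"
  shows "card (carrier R) = card (carrier K)"
proof (rule antisym)
  let ?q = "card (carrier K)"
  interpret K: field K by fact
  have q: "?q \<ge> 2"
  proof -
    have "card {\<zero>\<^bsub>K\<^esub>, \<one>\<^bsub>K\<^esub>} \<le> ?q" by (rule card_mono) (use K in auto)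
    then show ?thesis by simp
  qed
  have pow1: "x [^] (?q - 1) = \<one>" if x: "x \<in> carrier R" "x \<noteq> \<zero>" for x
  proof -
    let ?e = "x [^] (?q - 1)"
    have ex: "?e \<otimes> x = x" using pow[OF x(1)] q x nat_pow_Suc[of x "?q - 1"] by simp
    \<comment> \<open>One factor x is split off the second copy of \<open>?e\<close> and absorbed by
      the first; this needs q - 1 to be positive.\<close>
    have "?e \<otimes> ?e = (?e \<otimes> x) \<otimes> x [^] (?q - 2)"
      using x q nat_pow_Suc2[of x "?q - 2"] by (simp add: m_assoc numeral_2_eq_2 Suc_diff_Suc)
    also have "\<dots> = ?e" using ex x q nat_pow_Suc2[of x "?q - 2"] by (simp add: numeral_2_eq_2 Suc_diff_Suc)
    finally have "?e = \<zero> \<or> ?e = \<one>" using idem x by auto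
    then show ?thesis using ex x by auto
  qed
  have "domain R"
  proof (rule domainI[OF is_cring nz])
    fix a b assume ab: "a \<otimes> b = \<zero>" "a \<in> carrier R" "b \<in> carrier R"
    show "a = \<zero> \<or> b = \<zero>"
    proof (rule ccontr)
      assume "\<not> (a = \<zero> \<or> b = \<zero>)"
      then have "(a \<otimes> b) [^] (?q - 1) = \<one>"
        using pow1[of a] pow1[of b] ab(2,3) by (subst nat_pow_distrib) auto
      moreover have "(a \<otimes> b) [^] (?q - 1) = \<zero>" unfolding ab(1) by (rule nat_pow_zero) (use q in simp)
      ultimately show False using nz by simp
    qed
  qed
  then interpret domain R .
  have "carrier R \<subseteq> insert \<zero> {x \<in> carrier R. x [^] (?q - 1) = \<one>}" using pow1 by auto
  then have "card (carrier R) \<le> card (insert \<zero> {x \<in> carrier R. x [^] (?q - 1) = \<one>})"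
    by (intro card_mono) (use fin in auto)
  also have "\<dots> \<le> Suc (card {x \<in> carrier R. x [^] (?q - 1) = \<one>})" by (rule card_insert_le_m1) auto
  also have "\<dots> \<le> Suc (?q - 1)" using num_roots_le_deg[OF fin, of "?q - 1"] q by simp
  finally show "card (carrier R) \<le> ?q" using q by simp
  interpret ring_hom_ring K R \<phi>
    by (rule ring_hom_ringI2) (use K h K.ring_axioms ring_axioms in auto)
  have "\<one> \<in> \<phi> ` carrier K" using imageI[OF K.one_closed, of \<phi>] hom_one by simp
  then have "\<phi> ` carrier K \<noteq> {\<zero>}" using nz by blast
  then have "inj_on \<phi> (carrier K)" by (rule non_trivial_field_hom_imp_inj[OF K(1)])
  then show "?q \<le> card (carrier R)" by (rule card_inj_on_le) (use fin in auto)
qed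

text \<open>Both counts are multiplicative under splitting by an idempotent, so a common exponent
  survives the induction. The leaves are the zero ring, with n = 0, and a ring without nontrivial
  idempotents, with n = 1. The structure map varies in the induction because each corner has its
  own.\<close>

lemma idempotent_count:
  fixes R :: "('r, 'm) ring_scheme" and K :: "('a, 'b) ring_scheme"
  assumes "cring R" and "finite (carrier R)" and K: "field K" "finite (carrier K)"
    and "\<phi> \<in> ring_hom K R"
    and "\<And>x. x \<in> carrier R \<Longrightarrow> x [^]\<^bsub>R\<^esub> card (carrier K) = x"
  shows "\<exists>n. card (carrier R) = card (carrier K) ^ n
           \<and> card {e \<in> carrier R. e \<otimes>\<^bsub>R\<^esub> e = e} = 2 ^ n"
  using assms(1,2,5,6)
proof (induction "card (carrier R)" arbitrary: R \<phi> rule: less_induct)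
  case less
  interpret cring R by fact
  interpret K: field K by fact
  let ?q = "card (carrier K)"
  have q: "?q > 0" using K by (auto simp: card_gt_0_iff)
  consider "\<one>\<^bsub>R\<^esub> = \<zero>\<^bsub>R\<^esub>" | "\<one>\<^bsub>R\<^esub> \<noteq> \<zero>\<^bsub>R\<^esub>" "\<And>e. e \<in> carrier R \<Longrightarrow> e \<otimes>\<^bsub>R\<^esub> e = e \<Longrightarrow> e = \<zero>\<^bsub>R\<^esub> \<or> e = \<one>\<^bsub>R\<^esub>"
    | f where "f \<in> carrier R" "f \<otimes>\<^bsub>R\<^esub> f = f" "f \<noteq> \<zero>\<^bsub>R\<^esub>" "f \<noteq> \<one>\<^bsub>R\<^esub>" by blast
  then show ?case
  proof cases
    case 1
    then have "carrier R = {\<zero>\<^bsub>R\<^esub>}" using one_zeroD by blast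
    moreover from this have "{e \<in> carrier R. e \<otimes>\<^bsub>R\<^esub> e = e} = {\<zero>\<^bsub>R\<^esub>}" by auto
    ultimately show ?thesis by (intro exI[of _ 0]) simp
  next
    case 2
    have "card (carrier R) = ?q" by (rule no_idempotents_card[OF less.prems(2) K less.prems(3,4) 2])
    moreover have "{e \<in> carrier R. e \<otimes>\<^bsub>R\<^esub> e = e} = {\<zero>\<^bsub>R\<^esub>, \<one>\<^bsub>R\<^esub>}" using 2 by auto
    ultimately show ?thesis using 2 by (intro exI[of _ 1]) simp
  next
    case 3
    let ?g = "\<one>\<^bsub>R\<^esub> \<ominus>\<^bsub>R\<^esub> f"
    note d = corner_decomposition[OF 3(1,2)]
    have IH: "\<exists>n. card (carrier (corner R h)) = ?q ^ n
        \<and> card {x \<in> carrier (corner R h). x \<otimes>\<^bsub>corner R h\<^esub> x = x} = 2 ^ n"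
      if h: "h \<in> carrier R" "h \<otimes>\<^bsub>R\<^esub> h = h" "h \<noteq> \<one>\<^bsub>R\<^esub>" for h
    proof (rule less.hyps)
      \<comment> \<open>The unit of R lies in the corner only if it is fixed by \<open>h\<close>,
        that is, if \<open>h\<close> is the unit.\<close>
      have "carrier (corner R h) \<subset> carrier R"
      proof (rule psubsetI)
        show "carrier (corner R h) \<noteq> carrier R"
        proof
          assume "carrier (corner R h) = carrier R"
          then have "\<one>\<^bsub>R\<^esub> \<in> carrier (corner R h)" by simp
          then show False using h by simp
        qed
      qed auto
      then show "card (carrier (corner R h)) < card (carrier R)"
        using less.prems(2) by (rule psubset_card_mono[rotated])
      show "cring (corner R h)" by (rule corner_cring[OF h(1,2)])
      show "finite (carrier (corner R h))" using less.prems(2) by simp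
      show "(\<lambda>a. h \<otimes>\<^bsub>R\<^esub> \<phi> a) \<in> ring_hom K (corner R h)"
        by (rule corner_ring_hom[OF h(1,2) less.prems(3)])
      show "x [^]\<^bsub>corner R h\<^esub> ?q = x" if "x \<in> carrier (corner R h)" for x
        using corner_pow[OF h(1,2) that q] less.prems(4) that by simp
    qed
    \<comment> \<open>The induction hypothesis also needs the second corner to be proper;
      \<open>f\<close> annihilates \<open>?g\<close> but is nonzero.\<close>
    have "?g \<noteq> \<one>\<^bsub>R\<^esub>"
    proof
      assume "?g = \<one>\<^bsub>R\<^esub>"
      moreover have "f \<otimes>\<^bsub>R\<^esub> ?g = \<zero>\<^bsub>R\<^esub>" using 3 by (simp add: minus_eq r_distr r_minus r_neg)
      ultimately show False using 3 by simp
    qed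
    then obtain m n where
      m: "card (carrier (corner R f)) = ?q ^ m" "card {x \<in> carrier (corner R f). x \<otimes>\<^bsub>R\<^esub> x = x} = 2 ^ m" and
      n: "card (carrier (corner R ?g)) = ?q ^ n" "card {x \<in> carrier (corner R ?g). x \<otimes>\<^bsub>R\<^esub> x = x} = 2 ^ n"
      using IH[OF 3(1,2,4)] IH[OF d(1,2)] unfolding corner_simps(4) by blast
    have "card (carrier R) = ?q ^ (m + n)"
      by (subst bij_betw_same_card[OF d(3)]) (simp only: card_cartesian_product m n power_add)
    moreover have "card {e \<in> carrier R. e \<otimes>\<^bsub>R\<^esub> e = e} = 2 ^ (m + n)"
      by (subst bij_betw_same_card[OF d(4)]) (simp only: card_cartesian_product m n power_add)
    ultimately show ?thesis by blast
  qed
qed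

section \<open>Ideals and their idempotent generators\<close>

text \<open>Each y has the local unit y^(m-1), which lies in every ideal containing y. Local units
  can be joined, and since the ideal is finite, some element of it acts as a unit on the whole
  ideal; acting on itself, it is idempotent.\<close>

lemma (in cring) ideal_generated_by_idempotent:
  assumes fin: "finite (carrier R)" and pow: "\<And>x. x \<in> carrier R \<Longrightarrow> x [^] (m::nat) = x" and m: "m > 1"
    and I: "ideal I R"
  shows "\<exists>e\<in>I. e \<otimes> e = e \<and> PIdl e = I"
proof -
  interpret I: ideal I R by fact
  have "\<exists>e\<in>I. \<forall>x\<in>F. e \<otimes> x = x" if "finite F" "F \<subseteq> I" for F
    using that
  proof (induction F)
    case empty
    show ?case using I.zero_closed by blast
  next
    case (insert y F)
    then obtain e where e: "e \<in> I" "\<forall>x\<in>F. e \<otimes> x = x" by auto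
    let ?f = "y [^] (m - 1)"
    \<comment> \<open>This is 1 - (1 - e)(1 - f). Its complement annihilates whatever 1 - e or 1 - f
      annihilates, so \<open>?e\<close> fixes everything fixed by \<open>e\<close> or by
      \<open>?f\<close>.\<close>
    let ?e = "e \<oplus> (?f \<ominus> e \<otimes> ?f)"
    have y: "y \<in> I" "y \<in> carrier R" and eR: "e \<in> carrier R" and fR: "?f \<in> carrier R"
      using insert.prems e I.Icarr by auto
    have f: "?f = y \<otimes> y [^] (m - 2)" "?f \<otimes> y = y"
      using m y pow[of y] nat_pow_Suc2[of y "m - 2"] nat_pow_Suc[of y "m - 1"]
      by (simp_all add: numeral_2_eq_2 Suc_diff_Suc)
    have fI: "?f \<in> I" using f y by (simp add: I.I_r_closed)
    have "?e \<in> I" using e fI eR I.I_l_closed by (simp add: minus_eq I.a_closed I.a_inv_closed)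
    moreover have "?e \<otimes> x = x" if x: "x \<in> insert y F" for x
    proof -
      have xR: "x \<in> carrier R" using x insert.prems I.Icarr by auto
      have *: "?e \<otimes> x = e \<otimes> x \<oplus> (?f \<otimes> x \<ominus> e \<otimes> (?f \<otimes> x))"
        using xR eR fR by (simp add: minus_eq l_distr l_minus m_assoc)
      show ?thesis
      proof (cases "x = y")
        case True
        then show ?thesis using * f y eR by (simp add: minus_eq a_lcomm r_neg)
      next
        case False
        then have "e \<otimes> (?f \<otimes> x) = ?f \<otimes> x" using e x xR eR fR m_lcomm[OF eR fR xR] by simp
        then show ?thesis using * False e x xR fR by (auto simp: minus_eq r_neg)
      qed
    qed
    ultimately show ?case by blast
  qed
  \<comment> \<open>The finite set may be the ideal itself.\<close>
  from this[of I] obtain e where e: "e \<in> I" "\<forall>x\<in>I. e \<otimes> x = x"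
    using fin I.Icarr by (meson finite_subset subsetI subset_refl)
  have "PIdl e \<subseteq> I" by (rule cgenideal_minimal[OF I e(1)])
  moreover have "I \<subseteq> PIdl e"
  proof
    fix x assume x: "x \<in> I"
    then have "x = x \<otimes> e" using e I.Icarr m_comm by metis
    then show "x \<in> PIdl e" using I.Icarr[OF x] by (auto simp: cgenideal_def)
  qed
  ultimately show ?thesis using e by blast
qed

lemma (in cring) mem_cgenideal_idempotent:
  assumes "e \<in> carrier R" "e \<otimes> e = e"
  shows "x \<in> PIdl e \<longleftrightarrow> x \<in> carrier R \<and> e \<otimes> x = x"
proof
  assume "x \<in> PIdl e"
  then obtain y where "y \<in> carrier R" "x = y \<otimes> e" by (auto simp: cgenideal_def)
  then show "x \<in> carrier R \<and> e \<otimes> x = x"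
    using assms m_assoc[of e e y] by (simp add: m_comm[of y e])
next
  assume x: "x \<in> carrier R \<and> e \<otimes> x = x"
  then have "x = x \<otimes> e" using assms m_comm by metis
  then show "x \<in> PIdl e" using x unfolding cgenideal_def by blast
qed

lemma (in cring) idempotent_generator_unique:
  assumes "e \<in> carrier R" "e \<otimes> e = e" "f \<in> carrier R" "f \<otimes> f = f" "PIdl e = PIdl f"
  shows "e = f"
proof -
  have "f \<otimes> e = e" "e \<otimes> f = f"
    using assms mem_cgenideal_idempotent[of e] mem_cgenideal_idempotent[of f] by auto
  then show ?thesis using m_comm[OF assms(1,3)] by simp
qed


section \<open>Group algebras\<close>

locale finite_group_algebra = K: field K + G: comm_group G
  for K :: "('a, 'b) ring_scheme" (structure) and G :: "('g, 'h) monoid_scheme" +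
  assumes finG: "finite (carrier G)"
begin

abbreviation "KG \<equiv> group_algebra K G"

lemma KG_simps:
  "carrier KG = carrier G \<rightarrow>\<^sub>E carrier K"
  "\<zero>\<^bsub>KG\<^esub> = (\<lambda>g\<in>carrier G. \<zero>)"
  "\<one>\<^bsub>KG\<^esub> = (\<lambda>g\<in>carrier G. if g = \<one>\<^bsub>G\<^esub> then \<one> else \<zero>)"
  "u \<oplus>\<^bsub>KG\<^esub> v = (\<lambda>g\<in>carrier G. u g \<oplus> v g)"
  "u \<otimes>\<^bsub>KG\<^esub> v = (\<lambda>g\<in>carrier G. \<Oplus>h\<in>carrier G. u h \<otimes> v (inv\<^bsub>G\<^esub> h \<otimes>\<^bsub>G\<^esub> g))"
  by (simp_all add: group_algebra_def)

lemma KG_coeff [simp]: "u \<in> carrier KG \<Longrightarrow> g \<in> carrier G \<Longrightarrow> u g \<in> carrier K"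
  by (auto simp: KG_simps)

lemma KG_eqI:
  assumes "u \<in> carrier KG" "v \<in> carrier KG" "\<And>g. g \<in> carrier G \<Longrightarrow> u g = v g"
  shows "u = v"
  using assms by (auto simp: KG_simps intro: PiE_ext)

lemma KG_mult_closed: "u \<in> carrier KG \<Longrightarrow> v \<in> carrier KG \<Longrightarrow> u \<otimes>\<^bsub>KG\<^esub> v \<in> carrier KG"
  by (auto simp: KG_simps intro!: K.finsum_closed)

lemma KG_add_closed: "u \<in> carrier KG \<Longrightarrow> v \<in> carrier KG \<Longrightarrow> u \<oplus>\<^bsub>KG\<^esub> v \<in> carrier KG"
  by (auto simp: KG_simps)

lemma finsum_translate:
  assumes f: "f \<in> carrier G \<rightarrow> carrier K" and a: "a \<in> carrier G"
  shows "(\<Oplus>h\<in>carrier G. f (a \<otimes>\<^bsub>G\<^esub> h)) = (\<Oplus>h\<in>carrier G. f h)"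
proof -
  have "(\<Oplus>h\<in>carrier G. f (a \<otimes>\<^bsub>G\<^esub> h)) = (\<Oplus>h\<in>(\<lambda>h. a \<otimes>\<^bsub>G\<^esub> h) ` carrier G. f h)"
    by (rule K.finsum_reindex[symmetric]) (use f a G.inj_on_cmult[OF a] in auto)
  also have "(\<lambda>h. a \<otimes>\<^bsub>G\<^esub> h) ` carrier G = carrier G"
    by (rule G.surj_const_mult[OF a])
  finally show ?thesis .
qed

lemma finsum_inv:
  assumes f: "f \<in> carrier G \<rightarrow> carrier K"
  shows "(\<Oplus>h\<in>carrier G. f (inv\<^bsub>G\<^esub> h)) = (\<Oplus>h\<in>carrier G. f h)"
proof -
  have "(\<Oplus>h\<in>carrier G. f (inv\<^bsub>G\<^esub> h)) = (\<Oplus>h\<in>(\<lambda>h. inv\<^bsub>G\<^esub> h) ` carrier G. f h)"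
    by (rule K.finsum_reindex[symmetric]) (use f in \<open>auto intro!: inj_onI dest: G.inv_inj[THEN inj_onD]\<close>)
  also have "(\<lambda>h. inv\<^bsub>G\<^esub> h) ` carrier G = carrier G"
    by (auto simp: image_iff) (metis G.inv_closed G.inv_inv)
  finally show ?thesis .
qed

lemma finsum_commute:
  assumes fin: "finite I" "finite J" and f: "\<And>i j. i \<in> I \<Longrightarrow> j \<in> J \<Longrightarrow> f i j \<in> carrier K"
  shows "(\<Oplus>i\<in>I. \<Oplus>j\<in>J. f i j) = (\<Oplus>j\<in>J. \<Oplus>i\<in>I. f i j)"
  using fin(1) f
proof (induction I)
  case (insert i I)
  then have "(\<Oplus>i\<in>insert i I. \<Oplus>j\<in>J. f i j) = (\<Oplus>j\<in>J. f i j) \<oplus> (\<Oplus>j\<in>J. \<Oplus>i\<in>I. f i j)"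
    by (subst K.finsum_insert) (auto intro!: K.finsum_closed)
  also have "\<dots> = (\<Oplus>j\<in>J. f i j \<oplus> (\<Oplus>i\<in>I. f i j))"
    using insert.prems by (intro K.finsum_addf[symmetric]) (auto intro!: K.finsum_closed)
  also have "\<dots> = (\<Oplus>j\<in>J. \<Oplus>i\<in>insert i I. f i j)"
    using insert by (intro K.finsum_cong') (auto intro!: K.finsum_closed K.finsum_insert[symmetric])
  finally show ?case .
qed simp

lemma KG_mult_comm:
  assumes u: "u \<in> carrier KG" and v: "v \<in> carrier KG"
  shows "u \<otimes>\<^bsub>KG\<^esub> v = v \<otimes>\<^bsub>KG\<^esub> u"
proof (rule KG_eqI)
  fix g assume g: "g \<in> carrier G"
  let ?f = "\<lambda>h. v h \<otimes> u (inv\<^bsub>G\<^esub> h \<otimes>\<^bsub>G\<^esub> g)"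
  have f: "?f \<in> carrier G \<rightarrow> carrier K" using u v g by auto
  \<comment> \<open>The substitution h -> g - h, carried out as a translation followed by an
    inversion, exchanges the two factors of the convolution.\<close>
  have "(\<Oplus>h\<in>carrier G. ?f h) = (\<Oplus>h\<in>carrier G. ?f (g \<otimes>\<^bsub>G\<^esub> h))"
    by (rule finsum_translate[OF f g, symmetric])
  also have "\<dots> = (\<Oplus>h\<in>carrier G. ?f (g \<otimes>\<^bsub>G\<^esub> inv\<^bsub>G\<^esub> h))"
    by (rule finsum_inv[of "\<lambda>h. ?f (g \<otimes>\<^bsub>G\<^esub> h)", symmetric]) (use u v g in auto)
  also have "\<dots> = (\<Oplus>h\<in>carrier G. u h \<otimes> v (inv\<^bsub>G\<^esub> h \<otimes>\<^bsub>G\<^esub> g))"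
  proof (rule K.finsum_cong')
    fix h assume h: "h \<in> carrier G"
    have "inv\<^bsub>G\<^esub> (g \<otimes>\<^bsub>G\<^esub> inv\<^bsub>G\<^esub> h) \<otimes>\<^bsub>G\<^esub> g = h"
      using g h by (simp add: G.inv_mult_group G.m_assoc)
    then show "?f (g \<otimes>\<^bsub>G\<^esub> inv\<^bsub>G\<^esub> h) = u h \<otimes> v (inv\<^bsub>G\<^esub> h \<otimes>\<^bsub>G\<^esub> g)"
      using u v g h by (simp add: K.m_comm G.m_comm)
  qed (use u v g in auto)
  finally show "(u \<otimes>\<^bsub>KG\<^esub> v) g = (v \<otimes>\<^bsub>KG\<^esub> u) g" using g by (simp add: KG_simps)
qed (use u v KG_mult_closed in auto)

lemma KG_mult_assoc:
  assumes u: "u \<in> carrier KG" and v: "v \<in> carrier KG" and w: "w \<in> carrier KG"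
  shows "(u \<otimes>\<^bsub>KG\<^esub> v) \<otimes>\<^bsub>KG\<^esub> w = u \<otimes>\<^bsub>KG\<^esub> (v \<otimes>\<^bsub>KG\<^esub> w)"
proof (rule KG_eqI)
  fix g assume g: "g \<in> carrier G"
  let ?f = "\<lambda>k h. u k \<otimes> (v (inv\<^bsub>G\<^esub> k \<otimes>\<^bsub>G\<^esub> h) \<otimes> w (inv\<^bsub>G\<^esub> h \<otimes>\<^bsub>G\<^esub> g))"
  have "((u \<otimes>\<^bsub>KG\<^esub> v) \<otimes>\<^bsub>KG\<^esub> w) g = (\<Oplus>h\<in>carrier G. (\<Oplus>k\<in>carrier G. u k \<otimes> v (inv\<^bsub>G\<^esub> k \<otimes>\<^bsub>G\<^esub> h)) \<otimes> w (inv\<^bsub>G\<^esub> h \<otimes>\<^bsub>G\<^esub> g))"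
    using g u v w by (auto simp: KG_simps intro!: K.finsum_cong' K.finsum_closed)
  also have "\<dots> = (\<Oplus>h\<in>carrier G. \<Oplus>k\<in>carrier G. ?f k h)"
    using g u v w finG
    by (intro K.finsum_cong') (auto simp: K.finsum_ldistr K.m_assoc intro!: K.finsum_closed K.finsum_cong')
  also have "\<dots> = (\<Oplus>k\<in>carrier G. \<Oplus>h\<in>carrier G. ?f k h)"
    by (rule finsum_commute[OF finG finG]) (use g u v w in auto)
  also have "\<dots> = (\<Oplus>k\<in>carrier G. u k \<otimes> (\<Oplus>h\<in>carrier G. v h \<otimes> w (inv\<^bsub>G\<^esub> h \<otimes>\<^bsub>G\<^esub> (inv\<^bsub>G\<^esub> k \<otimes>\<^bsub>G\<^esub> g))))"
  proof (rule K.finsum_cong')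
    fix k assume k: "k \<in> carrier G"
    let ?F = "\<lambda>h. v (inv\<^bsub>G\<^esub> k \<otimes>\<^bsub>G\<^esub> h) \<otimes> w (inv\<^bsub>G\<^esub> h \<otimes>\<^bsub>G\<^esub> g)"
    have F: "?F \<in> carrier G \<rightarrow> carrier K" using k g v w by auto
    have "(\<Oplus>h\<in>carrier G. ?f k h) = u k \<otimes> (\<Oplus>h\<in>carrier G. ?F h)"
      by (rule K.finsum_rdistr[symmetric]) (use finG u k F in auto)
    \<comment> \<open>Translating the inner sum by \<open>k\<close> moves the shift from the
      argument of \<open>v\<close> into that of \<open>w\<close>, where it forms the inner
      convolution.\<close>
    also have "(\<Oplus>h\<in>carrier G. ?F h) = (\<Oplus>h\<in>carrier G. ?F (k \<otimes>\<^bsub>G\<^esub> h))"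
      by (rule finsum_translate[OF F k, symmetric])
    also have "\<dots> = (\<Oplus>h\<in>carrier G. v h \<otimes> w (inv\<^bsub>G\<^esub> h \<otimes>\<^bsub>G\<^esub> (inv\<^bsub>G\<^esub> k \<otimes>\<^bsub>G\<^esub> g)))"
    proof (rule K.finsum_cong')
      fix h assume h: "h \<in> carrier G"
      have "inv\<^bsub>G\<^esub> k \<otimes>\<^bsub>G\<^esub> (k \<otimes>\<^bsub>G\<^esub> h) = h" using h k by (simp add: G.m_assoc[symmetric])
      then show "?F (k \<otimes>\<^bsub>G\<^esub> h) = v h \<otimes> w (inv\<^bsub>G\<^esub> h \<otimes>\<^bsub>G\<^esub> (inv\<^bsub>G\<^esub> k \<otimes>\<^bsub>G\<^esub> g))"
        using h k g by (simp add: G.inv_mult_group G.m_assoc)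
    qed (use v w g k in auto)
    finally show "(\<Oplus>h\<in>carrier G. ?f k h) = u k \<otimes> (\<Oplus>h\<in>carrier G. v h \<otimes> w (inv\<^bsub>G\<^esub> h \<otimes>\<^bsub>G\<^esub> (inv\<^bsub>G\<^esub> k \<otimes>\<^bsub>G\<^esub> g)))" .
  qed (use u v w g in \<open>auto intro!: K.finsum_closed\<close>)
  also have "\<dots> = (u \<otimes>\<^bsub>KG\<^esub> (v \<otimes>\<^bsub>KG\<^esub> w)) g"
    using g u v w by (auto simp: KG_simps intro!: K.finsum_cong' K.finsum_closed)
  finally show "((u \<otimes>\<^bsub>KG\<^esub> v) \<otimes>\<^bsub>KG\<^esub> w) g = (u \<otimes>\<^bsub>KG\<^esub> (v \<otimes>\<^bsub>KG\<^esub> w)) g" .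
qed (use u v w KG_mult_closed in auto)

text \<open>The element c Y^a of the group algebra.\<close>

definition monomial :: "'g \<Rightarrow> 'a \<Rightarrow> 'g \<Rightarrow> 'a" where
  "monomial a c = (\<lambda>g\<in>carrier G. if g = a then c else \<zero>)"

lemma monomial_closed [simp]: "c \<in> carrier K \<Longrightarrow> monomial a c \<in> carrier KG"
  by (auto simp: monomial_def KG_simps)

lemma monomial_mult_coeff:
  assumes a: "a \<in> carrier G" and c: "c \<in> carrier K" and v: "v \<in> carrier KG" and g: "g \<in> carrier G"
  shows "(monomial a c \<otimes>\<^bsub>KG\<^esub> v) g = c \<otimes> v (inv\<^bsub>G\<^esub> a \<otimes>\<^bsub>G\<^esub> g)"
proof -
  have "(monomial a c \<otimes>\<^bsub>KG\<^esub> v) g = (\<Oplus>h\<in>carrier G. if a = h then c \<otimes> v (inv\<^bsub>G\<^esub> h \<otimes>\<^bsub>G\<^esub> g) else \<zero>)"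
    using a c v g by (auto simp: KG_simps(5) monomial_def intro!: K.finsum_cong')
  also have "\<dots> = c \<otimes> v (inv\<^bsub>G\<^esub> a \<otimes>\<^bsub>G\<^esub> g)"
    by (rule K.finsum_singleton[OF a finG]) (use c v g in auto)
  finally show ?thesis .
qed

lemma one_eq_monomial: "\<one>\<^bsub>KG\<^esub> = monomial \<one>\<^bsub>G\<^esub> \<one>"
  by (simp add: KG_simps monomial_def)

lemma KG_cring: "cring KG"
proof (rule cringI)
  show "abelian_group KG"
  proof (rule abelian_groupI)
    fix x assume x: "x \<in> carrier KG"
    show "\<exists>y\<in>carrier KG. y \<oplus>\<^bsub>KG\<^esub> x = \<zero>\<^bsub>KG\<^esub>"
      using x by (intro bexI[of _ "\<lambda>g\<in>carrier G. \<ominus> x g"])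
        (auto simp: KG_simps PiE_iff K.l_neg intro!: restrict_ext)
  next
    fix x assume x: "x \<in> carrier KG"
    then show "\<zero>\<^bsub>KG\<^esub> \<oplus>\<^bsub>KG\<^esub> x = x"
      by (intro KG_eqI) (auto simp: KG_simps PiE_iff)
  qed (auto simp: KG_simps PiE_iff K.a_ac intro!: restrict_ext)
  show "comm_monoid KG"
  proof (rule comm_monoidI)
    fix x assume x: "x \<in> carrier KG"
    show "\<one>\<^bsub>KG\<^esub> \<otimes>\<^bsub>KG\<^esub> x = x"
      by (rule KG_eqI) (use x in \<open>auto simp: one_eq_monomial monomial_mult_coeff KG_mult_closed\<close>)
  qed (auto simp: KG_mult_closed KG_mult_assoc one_eq_monomial intro: KG_mult_comm)
  show "(x \<oplus>\<^bsub>KG\<^esub> y) \<otimes>\<^bsub>KG\<^esub> z = x \<otimes>\<^bsub>KG\<^esub> z \<oplus>\<^bsub>KG\<^esub> y \<otimes>\<^bsub>KG\<^esub> z"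
    if "x \<in> carrier KG" "y \<in> carrier KG" "z \<in> carrier KG" for x y z
  proof (rule KG_eqI)
    fix g assume g: "g \<in> carrier G"
    have "((x \<oplus>\<^bsub>KG\<^esub> y) \<otimes>\<^bsub>KG\<^esub> z) g = (\<Oplus>h\<in>carrier G. (x \<oplus>\<^bsub>KG\<^esub> y) h \<otimes> z (inv\<^bsub>G\<^esub> h \<otimes>\<^bsub>G\<^esub> g))"
      using g by (simp add: KG_simps(5))
    also have "\<dots> = (\<Oplus>h\<in>carrier G. x h \<otimes> z (inv\<^bsub>G\<^esub> h \<otimes>\<^bsub>G\<^esub> g) \<oplus> y h \<otimes> z (inv\<^bsub>G\<^esub> h \<otimes>\<^bsub>G\<^esub> g))"
      by (rule K.finsum_cong') (use that g in \<open>auto simp: KG_simps(4) K.l_distr\<close>)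
    also have "\<dots> = (x \<otimes>\<^bsub>KG\<^esub> z \<oplus>\<^bsub>KG\<^esub> y \<otimes>\<^bsub>KG\<^esub> z) g"
      using that g by (subst K.finsum_addf) (auto simp: KG_simps(4,5))
    finally show "((x \<oplus>\<^bsub>KG\<^esub> y) \<otimes>\<^bsub>KG\<^esub> z) g = (x \<otimes>\<^bsub>KG\<^esub> z \<oplus>\<^bsub>KG\<^esub> y \<otimes>\<^bsub>KG\<^esub> z) g" .
  qed (use that KG_add_closed KG_mult_closed in auto)
qed

end


context finite_group_algebra
begin

sublocale R: cring KG by (rule KG_cring)

lemma KG_finsum_coeff:
  assumes "finite I" "f \<in> I \<rightarrow> carrier KG" and g: "g \<in> carrier G"
  shows "(\<Oplus>\<^bsub>KG\<^esub>i\<in>I. f i) g = (\<Oplus>i\<in>I. f i g)"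
  using assms(1,2)
proof (induction I)
  case empty
  then show ?case using g by (simp add: KG_simps)
next
  case (insert i I)
  have "(\<Oplus>\<^bsub>KG\<^esub>i\<in>insert i I. f i) g = (f i \<oplus>\<^bsub>KG\<^esub> (\<Oplus>\<^bsub>KG\<^esub>i\<in>I. f i)) g"
    using insert by (subst R.finsum_insert) auto
  also have "\<dots> = (\<Oplus>i\<in>insert i I. f i g)"
    using insert g by (subst K.finsum_insert) (auto simp: KG_simps(4) Pi_iff)
  finally show ?case .
qed

lemma monomial_decomposition:
  assumes u: "u \<in> carrier KG"
  shows "u = (\<Oplus>\<^bsub>KG\<^esub>a\<in>carrier G. monomial a (u a))"
proof (rule KG_eqI)
  fix g assume g: "g \<in> carrier G"
  have "(\<Oplus>\<^bsub>KG\<^esub>a\<in>carrier G. monomial a (u a)) g = (\<Oplus>a\<in>carrier G. if g = a then u a else \<zero>)"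
  proof (subst KG_finsum_coeff)
    show "(\<Oplus>a\<in>carrier G. monomial a (u a) g) = (\<Oplus>a\<in>carrier G. if g = a then u a else \<zero>)"
      using u g by (intro K.finsum_cong') (auto simp: monomial_def)
  qed (use u g finG in auto)
  also have "\<dots> = u g" using u g finG by (subst K.finsum_singleton) auto
  finally show "u g = (\<Oplus>\<^bsub>KG\<^esub>a\<in>carrier G. monomial a (u a)) g" ..
qed (use u in \<open>auto intro!: R.finsum_closed\<close>)

lemma monomial_mult:
  assumes "a \<in> carrier G" "b \<in> carrier G" "c \<in> carrier K" "d \<in> carrier K"
  shows "monomial a c \<otimes>\<^bsub>KG\<^esub> monomial b d = monomial (a \<otimes>\<^bsub>G\<^esub> b) (c \<otimes> d)"
proof (rule KG_eqI)
  fix g assume g: "g \<in> carrier G"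
  have "inv\<^bsub>G\<^esub> a \<otimes>\<^bsub>G\<^esub> g = b \<longleftrightarrow> g = a \<otimes>\<^bsub>G\<^esub> b"
    using assms g by (metis G.inv_solve_left)
  then show "(monomial a c \<otimes>\<^bsub>KG\<^esub> monomial b d) g = monomial (a \<otimes>\<^bsub>G\<^esub> b) (c \<otimes> d) g"
    using assms g by (simp add: monomial_mult_coeff) (simp add: monomial_def)
qed (use assms in \<open>auto intro!: R.m_closed\<close>)

lemma monomial_pow:
  assumes "a \<in> carrier G" "c \<in> carrier K"
  shows "monomial a c [^]\<^bsub>KG\<^esub> (n::nat) = monomial (a [^]\<^bsub>G\<^esub> n) (c [^] n)"
  using assms by (induction n) (simp_all add: one_eq_monomial monomial_mult)

lemma KG_add_pow_coeff:
  assumes u: "u \<in> carrier KG" and g: "g \<in> carrier G"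
  shows "(add_pow KG (n::nat) u) g = add_pow K n (u g)"
  using assms
proof (induction n)
  case 0
  then show ?case by (simp add: KG_simps)
next
  case (Suc n)
  then show ?case using R.add.nat_pow_closed[OF u] by (simp add: KG_simps(4))
qed

text \<open>The scalars c Y^0 provide the K-algebra structure that the counting of idempotents
  requires.\<close>

lemma monomial_ring_hom: "monomial \<one>\<^bsub>G\<^esub> \<in> ring_hom K KG"
proof (rule ring_hom_memI)
  show "monomial \<one>\<^bsub>G\<^esub> (a \<oplus> b) = monomial \<one>\<^bsub>G\<^esub> a \<oplus>\<^bsub>KG\<^esub> monomial \<one>\<^bsub>G\<^esub> b"
    if "a \<in> carrier K" "b \<in> carrier K" for a b
    using that by (auto simp: KG_simps monomial_def intro!: restrict_ext)
qed (auto simp: monomial_mult one_eq_monomial)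

subsection \<open>The involution induced by inversion\<close>

definition flip :: "('g \<Rightarrow> 'a) \<Rightarrow> 'g \<Rightarrow> 'a" where
  "flip u = (\<lambda>g\<in>carrier G. u (inv\<^bsub>G\<^esub> g))"

lemma flip_closed [simp]: "u \<in> carrier KG \<Longrightarrow> flip u \<in> carrier KG"
  by (auto simp: flip_def KG_simps)

lemma flip_flip [simp]: "u \<in> carrier KG \<Longrightarrow> flip (flip u) = u"
  by (rule KG_eqI) (auto simp: flip_def KG_simps(1))

lemma flip_one [simp]: "flip \<one>\<^bsub>KG\<^esub> = \<one>\<^bsub>KG\<^esub>"
  by (rule KG_eqI) (auto simp: flip_def KG_simps)

lemma flip_zero [simp]: "flip \<zero>\<^bsub>KG\<^esub> = \<zero>\<^bsub>KG\<^esub>"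
  by (rule KG_eqI) (auto simp: flip_def KG_simps)

lemma flip_monomial_one [simp]: "c \<in> carrier K \<Longrightarrow> flip (monomial \<one>\<^bsub>G\<^esub> c) = monomial \<one>\<^bsub>G\<^esub> c"
  by (rule KG_eqI; simp?) (auto simp: flip_def monomial_def)

lemma flip_add: "u \<in> carrier KG \<Longrightarrow> v \<in> carrier KG \<Longrightarrow> flip (u \<oplus>\<^bsub>KG\<^esub> v) = flip u \<oplus>\<^bsub>KG\<^esub> flip v"
  by (rule KG_eqI; simp?) (auto simp: flip_def KG_simps(4))

lemma flip_mult:
  assumes u: "u \<in> carrier KG" and v: "v \<in> carrier KG"
  shows "flip (u \<otimes>\<^bsub>KG\<^esub> v) = flip u \<otimes>\<^bsub>KG\<^esub> flip v"
proof (rule KG_eqI)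
  fix g assume g: "g \<in> carrier G"
  let ?f = "\<lambda>h. u h \<otimes> v (inv\<^bsub>G\<^esub> h \<otimes>\<^bsub>G\<^esub> inv\<^bsub>G\<^esub> g)"
  have "flip (u \<otimes>\<^bsub>KG\<^esub> v) g = (\<Oplus>h\<in>carrier G. ?f h)"
    using g by (simp add: flip_def KG_simps(5))
  also have "\<dots> = (\<Oplus>h\<in>carrier G. ?f (inv\<^bsub>G\<^esub> h))"
    by (rule finsum_inv[symmetric]) (use u v g in auto)
  also have "\<dots> = (flip u \<otimes>\<^bsub>KG\<^esub> flip v) g"
    using u v g by (auto simp: KG_simps(5) flip_def G.inv_mult_group G.m_comm intro!: K.finsum_cong')
  finally show "flip (u \<otimes>\<^bsub>KG\<^esub> v) g = (flip u \<otimes>\<^bsub>KG\<^esub> flip v) g" .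
qed (use u v in auto)

lemma flip_minus: "u \<in> carrier KG \<Longrightarrow> flip (\<ominus>\<^bsub>KG\<^esub> u) = \<ominus>\<^bsub>KG\<^esub> flip u"
  using flip_add[of u "\<ominus>\<^bsub>KG\<^esub> u"]
  by (metis R.a_inv_closed R.minus_equality R.r_neg R.a_comm flip_closed flip_zero)

lemma euclidean_inner_eq_coeff:
  assumes "u \<in> carrier KG" "v \<in> carrier KG"
  shows "euclidean_inner K G u v = (u \<otimes>\<^bsub>KG\<^esub> flip v) \<one>\<^bsub>G\<^esub>"
  using assms by (auto simp: euclidean_inner_def KG_simps(5) flip_def intro!: K.finsum_cong')

text \<open>Orthogonality controls only the coefficient at 0, but an ideal is closed under
  multiplication by every Y^(-g), which brings the coefficient at g to 0. Thus the dual is the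
  flipped annihilator of the code.\<close>

lemma mem_euclidean_dual_iff:
  assumes C: "ideal C KG" and v: "v \<in> carrier KG"
  shows "v \<in> euclidean_dual K G C \<longleftrightarrow> (\<forall>c\<in>C. c \<otimes>\<^bsub>KG\<^esub> flip v = \<zero>\<^bsub>KG\<^esub>)"
proof
  interpret C: ideal C KG by fact
  assume dual: "v \<in> euclidean_dual K G C"
  show "\<forall>c\<in>C. c \<otimes>\<^bsub>KG\<^esub> flip v = \<zero>\<^bsub>KG\<^esub>"
  proof
    fix c assume c: "c \<in> C"
    then have cR: "c \<in> carrier KG" by (rule C.Icarr)
    show "c \<otimes>\<^bsub>KG\<^esub> flip v = \<zero>\<^bsub>KG\<^esub>"
    proof (rule KG_eqI)
      fix g assume g: "g \<in> carrier G"
      \<comment> \<open>Multiplication by Y^(-g) moves the coefficient at \<open>g\<close> to the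
        neutral element.\<close>
      let ?m = "monomial (inv\<^bsub>G\<^esub> g) \<one>"
      have "?m \<otimes>\<^bsub>KG\<^esub> c \<in> C" using c by (simp add: C.I_l_closed)
      then have "(?m \<otimes>\<^bsub>KG\<^esub> c \<otimes>\<^bsub>KG\<^esub> flip v) \<one>\<^bsub>G\<^esub> = \<zero>"
        using dual v cR euclidean_inner_eq_coeff[of "?m \<otimes>\<^bsub>KG\<^esub> c" v] by (auto simp: euclidean_dual_def)
      also have "?m \<otimes>\<^bsub>KG\<^esub> c \<otimes>\<^bsub>KG\<^esub> flip v = ?m \<otimes>\<^bsub>KG\<^esub> (c \<otimes>\<^bsub>KG\<^esub> flip v)"
        using cR v by (simp add: R.m_assoc)
      also have "\<dots> \<one>\<^bsub>G\<^esub> = (c \<otimes>\<^bsub>KG\<^esub> flip v) g"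
        using cR v g by (subst monomial_mult_coeff) auto
      finally show "(c \<otimes>\<^bsub>KG\<^esub> flip v) g = \<zero>\<^bsub>KG\<^esub> g" using g by (simp add: KG_simps(2))
    qed (use cR v in auto)
  qed
next
  interpret C: ideal C KG by fact
  assume "\<forall>c\<in>C. c \<otimes>\<^bsub>KG\<^esub> flip v = \<zero>\<^bsub>KG\<^esub>"
  then show "v \<in> euclidean_dual K G C"
    using v C.Icarr by (auto simp: euclidean_dual_def euclidean_inner_eq_coeff KG_simps(2))
qed

text \<open>The element e - e flip(e) always lies in the code and in its dual, so complementary
  duality forces e = e flip(e), and flipping this gives symmetry. Conversely, a common element v
  satisfies e v = v and e flip(v) = 0; flipping the latter gives e v = 0 when e is
  symmetric.\<close>

lemma complementary_dual_iff_flip_fixed: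
  assumes e: "e \<in> carrier KG" "e \<otimes>\<^bsub>KG\<^esub> e = e"
  shows "euclidean_complementary_dual K G (PIdl\<^bsub>KG\<^esub> e) \<longleftrightarrow> flip e = e"
proof
  let ?C = "PIdl\<^bsub>KG\<^esub> e"
  have C: "ideal ?C KG" by (rule R.cgenideal_ideal[OF e(1)])
  note mem = R.mem_cgenideal_idempotent[OF e]
  {
    assume cd: "euclidean_complementary_dual K G ?C"
    \<comment> \<open>The part of \<open>e\<close> outside the ideal generated by
      \<open>flip e\<close>; its flip is annihilated by \<open>e\<close>.\<close>
    let ?v = "e \<ominus>\<^bsub>KG\<^esub> e \<otimes>\<^bsub>KG\<^esub> flip e"
    have vR: "?v \<in> carrier KG" using e by simp
    have ee: "e \<otimes>\<^bsub>KG\<^esub> (e \<otimes>\<^bsub>KG\<^esub> z) = e \<otimes>\<^bsub>KG\<^esub> z" if "z \<in> carrier KG" for z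
      using e that by (simp add: R.m_assoc[symmetric])
    have fv: "flip ?v = flip e \<ominus>\<^bsub>KG\<^esub> flip e \<otimes>\<^bsub>KG\<^esub> e"
      using e by (simp add: R.minus_eq flip_add flip_minus flip_mult)
    have ev: "e \<otimes>\<^bsub>KG\<^esub> flip ?v = \<zero>\<^bsub>KG\<^esub>"
      unfolding fv using e ee by (simp add: R.minus_eq R.r_distr R.r_minus R.m_comm[of "flip e" e] R.r_neg)
    have "c \<otimes>\<^bsub>KG\<^esub> flip ?v = \<zero>\<^bsub>KG\<^esub>" if "c \<in> ?C" for c
    proof -
      have c: "c \<in> carrier KG" "e \<otimes>\<^bsub>KG\<^esub> c = c" using that mem by auto
      then have "c \<otimes>\<^bsub>KG\<^esub> flip ?v = c \<otimes>\<^bsub>KG\<^esub> (e \<otimes>\<^bsub>KG\<^esub> flip ?v)"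
        using e vR by (metis R.m_assoc R.m_comm flip_closed)
      then show ?thesis using c ev by simp
    qed
    then have "?v \<in> euclidean_dual K G ?C" using mem_euclidean_dual_iff[OF C vR] by blast
    moreover have "?v \<in> ?C" using mem e ee by (simp add: R.minus_eq R.r_distr R.r_minus)
    ultimately have "?v = \<zero>\<^bsub>KG\<^esub>" using cd by (auto simp: euclidean_complementary_dual_def)
    then have eq: "e = e \<otimes>\<^bsub>KG\<^esub> flip e" using e R.r_right_minus_eq[of e "e \<otimes>\<^bsub>KG\<^esub> flip e"] by simp
    \<comment> \<open>Flipping \<open>e = e flip(e)\<close> gives the same product in the other
      order, so \<open>e\<close> and \<open>flip e\<close> coincide.\<close>
    then have "flip e = flip e \<otimes>\<^bsub>KG\<^esub> e" using e flip_mult[of e "flip e"] by simp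
    then show "flip e = e" using eq e by (metis R.m_comm flip_closed)
  }
  assume fix_e: "flip e = e"
  have "v = \<zero>\<^bsub>KG\<^esub>" if v: "v \<in> ?C" "v \<in> euclidean_dual K G ?C" for v
  proof -
    have vR: "v \<in> carrier KG" "e \<otimes>\<^bsub>KG\<^esub> v = v" using v mem by auto
    have "e \<otimes>\<^bsub>KG\<^esub> flip v = \<zero>\<^bsub>KG\<^esub>"
      using v mem_euclidean_dual_iff[OF C vR(1)] R.cgenideal_self[OF e(1)] by blast
    then have "flip (e \<otimes>\<^bsub>KG\<^esub> flip v) = \<zero>\<^bsub>KG\<^esub>" by simp
    then show ?thesis using e vR fix_e by (simp add: flip_mult)
  qed
  moreover have "\<zero>\<^bsub>KG\<^esub> \<in> ?C" using mem e by simp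
  moreover have "\<zero>\<^bsub>KG\<^esub> \<in> euclidean_dual K G ?C"
    using mem_euclidean_dual_iff[OF C R.zero_closed] C ideal.Icarr[OF C] by simp
  ultimately show "euclidean_complementary_dual K G ?C"
    unfolding euclidean_complementary_dual_def by blast
qed

end

text \<open>A function constant on classes is a function on the set of classes. The hypotheses say
  that the sets \<open>c a\<close> partition \<open>A\<close>, in the form in which orbits provide
  it.\<close>

lemma card_class_functions:
  assumes fin: "finite A"
    and self: "\<And>a. a \<in> A \<Longrightarrow> a \<in> c a" and sub: "\<And>a. a \<in> A \<Longrightarrow> c a \<subseteq> A"
    and eq: "\<And>a b. a \<in> A \<Longrightarrow> b \<in> c a \<Longrightarrow> c b = c a"
  shows "card {u \<in> A \<rightarrow>\<^sub>E B. \<forall>a\<in>A. \<forall>b\<in>c a. u b = u a} = card B ^ card (c ` A)"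
proof -
  let ?h = "\<lambda>f. \<lambda>a\<in>A. f (c a)"
  have "bij_betw ?h (Pi\<^sub>E (c ` A) (\<lambda>_. B)) {u \<in> A \<rightarrow>\<^sub>E B. \<forall>a\<in>A. \<forall>b\<in>c a. u b = u a}"
  proof (rule bij_betw_imageI)
    show "inj_on ?h (Pi\<^sub>E (c ` A) (\<lambda>_. B))"
    proof (rule inj_onI)
    fix v w assume f: "v \<in> Pi\<^sub>E (c ` A) (\<lambda>_. B)" and g: "w \<in> Pi\<^sub>E (c ` A) (\<lambda>_. B)" and fg: "?h v = ?h w"
    show "v = w"
    proof (rule PiE_ext[OF f g])
      fix D assume "D \<in> c ` A"
      then obtain a where "a \<in> A" "D = c a" by blast
      then show "v D = w D" using fun_cong[OF fg, of a] by simp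
    qed
    qed
    show "?h ` Pi\<^sub>E (c ` A) (\<lambda>_. B) = {u \<in> A \<rightarrow>\<^sub>E B. \<forall>a\<in>A. \<forall>b\<in>c a. u b = u a}"
    proof (intro equalityI subsetI)
    fix u assume "u \<in> ?h ` Pi\<^sub>E (c ` A) (\<lambda>_. B)"
    then obtain f where f: "f \<in> Pi\<^sub>E (c ` A) (\<lambda>_. B)" and u: "u = ?h f" by blast
    have "u b = u a" if "a \<in> A" "b \<in> c a" for a b
      using that sub[OF that(1)] eq[OF that] by (auto simp: u)
    then show "u \<in> {u \<in> A \<rightarrow>\<^sub>E B. \<forall>a\<in>A. \<forall>b\<in>c a. u b = u a}"
      using f by (auto simp: u)
  next
    fix u assume u: "u \<in> {u \<in> A \<rightarrow>\<^sub>E B. \<forall>a\<in>A. \<forall>b\<in>c a. u b = u a}"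
    \<comment> \<open>The value on a class is taken at an arbitrary representative, which is
      harmless because \<open>u\<close> is constant there.\<close>
    let ?f = "\<lambda>D\<in>c ` A. u (SOME b. b \<in> D)"
    have val: "u (SOME b. b \<in> c a) = u a" if "a \<in> A" for a
      using u that someI[of "\<lambda>b. b \<in> c a", OF self[OF that]] by auto
    have "?f \<in> Pi\<^sub>E (c ` A) (\<lambda>_. B)" using val u by auto
    moreover have "u = ?h ?f" using val u by (auto simp: fun_eq_iff PiE_iff extensional_def)
    ultimately show "u \<in> ?h ` (Pi\<^sub>E (c ` A) (\<lambda>_. B))" by blast
    qed
  qed
  then have "card (Pi\<^sub>E (c ` A) (\<lambda>_. B)) = card {u \<in> A \<rightarrow>\<^sub>E B. \<forall>a\<in>A. \<forall>b\<in>c a. u b = u a}"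
    by (rule bij_betw_same_card)
  then show ?thesis using card_PiE[of "c ` A" "\<lambda>_. B"] fin by simp
qed


section \<open>Cyclotomic classes\<close>

text \<open>Each class D contributes \<open>card D\<close> summands equal to 1 /
  \<open>card D\<close>. The sum over elements can then be regrouped by element order without
  choosing representatives.\<close>

lemma card_classes_eq_sum:
  assumes fin: "finite A"
    and self: "\<And>a. a \<in> A \<Longrightarrow> a \<in> c a" and sub: "\<And>a. a \<in> A \<Longrightarrow> c a \<subseteq> A"
    and eq: "\<And>a b. a \<in> A \<Longrightarrow> b \<in> c a \<Longrightarrow> c b = c a"
  shows "real (card (c ` A)) = (\<Sum>a\<in>A. 1 / real (card (c a)))"
proof -
  have "(\<Sum>a\<in>A. 1 / real (card (c a))) = (\<Sum>D\<in>c ` A. \<Sum>a\<in>{a \<in> A. c a = D}. 1 / real (card (c a)))"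
    by (rule sum.image_gen[OF fin])
  also have "\<dots> = (\<Sum>D\<in>c ` A. 1)"
  proof (rule sum.cong[OF refl])
    fix D assume "D \<in> c ` A"
    then obtain d where d: "d \<in> A" "D = c d" by blast
    have "{a \<in> A. c a = D} = D" using d self sub eq by blast
    moreover have "card D > 0" using d self[OF d(1)] finite_subset[OF sub[OF d(1)] fin]
      by (auto simp: card_gt_0_iff)
    moreover have "(\<Sum>a\<in>{a \<in> A. c a = D}. 1 / real (card (c a))) = (\<Sum>a\<in>{a \<in> A. c a = D}. 1 / real (card D))"
      by (rule sum.cong) auto
    ultimately show "(\<Sum>a\<in>{a \<in> A. c a = D}. 1 / real (card (c a))) = 1" by simp
  qed
  finally show ?thesis by simp
qed

text \<open>The assumption \<open>period\<close> makes multiplication by q invertible by its own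
  powers. Only then are the forward orbits, which use nonnegative exponents alone, the blocks of a
  partition.\<close>

locale cyclotomic_classes = comm_group G for G :: "('g, 'h) monoid_scheme" (structure) +
  fixes q t :: nat
  assumes finG: "finite (carrier G)"
    and t_pos: "t > 0"
    and period: "\<And>a. a \<in> carrier G \<Longrightarrow> a [^] (q ^ t) = a"
begin

abbreviation cls :: "'g \<Rightarrow> 'g set" where "cls \<equiv> cyclotomic_class G q"

text \<open>The orbit of \<open>a\<close> under multiplication by q and by -1.\<close>

definition sym_cls :: "'g \<Rightarrow> 'g set" where "sym_cls a = cls a \<union> cls (inv a)"

lemma self_in_cls: "a \<in> carrier G \<Longrightarrow> a \<in> cls a"
  unfolding cyclotomic_class_def by (auto intro!: exI[of _ 0])

lemma cls_subset: "a \<in> carrier G \<Longrightarrow> cls a \<subseteq> carrier G"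
  unfolding cyclotomic_class_def by auto

lemma finite_cls: "a \<in> carrier G \<Longrightarrow> finite (cls a)"
  using cls_subset finG finite_subset by blast

lemma cls_pow: "a \<in> carrier G \<Longrightarrow> b \<in> cls a \<Longrightarrow> b [^] (q ^ i) \<in> cls a"
  unfolding cyclotomic_class_def by (auto simp: nat_pow_pow power_add[symmetric])

lemma cls_eq:
  assumes a: "a \<in> carrier G" and b: "b \<in> cls a"
  shows "cls b = cls a"
proof
  have sub: "cls y \<subseteq> cls x" if "x \<in> carrier G" "y \<in> cls x" for x y
    using cls_pow[OF that] by (auto simp: cyclotomic_class_def[of G q y])
  show "cls b \<subseteq> cls a" by (rule sub[OF a b])
  obtain i where i: "b = a [^] (q ^ i)" using b by (auto simp: cyclotomic_class_def)
  have per: "a [^] (q ^ (t * n)) = a" for n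
  proof (induction n)
    case (Suc n)
    have "a [^] (q ^ (t * Suc n)) = (a [^] (q ^ (t * n))) [^] (q ^ t)"
      using a by (simp add: nat_pow_pow power_add mult.commute)
    then show ?case using Suc a period by simp
  qed (use a in simp)
  \<comment> \<open>Going from \<open>b\<close> back to \<open>a\<close> means going forward to the
    next multiple of the period; \<open>t * i\<close> is one that is at least
    \<open>i\<close>.\<close>
  have "i \<le> t * i" using t_pos by simp
  then have "b [^] (q ^ (t * i - i)) = a"
    using a per[of i] by (simp add: i nat_pow_pow power_add[symmetric])
  then have "a \<in> cls b" unfolding cyclotomic_class_def by blast
  moreover have "b \<in> carrier G" using a b cls_subset by blast
  ultimately show "cls a \<subseteq> cls b" by (rule sub[rotated])
qed

lemma cls_inv: "a \<in> carrier G \<Longrightarrow> cls (inv a) = m_inv G ` cls a"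
proof -
  assume a: "a \<in> carrier G"
  have "cls x = range (\<lambda>i::nat. x [^] (q ^ i))" for x
    unfolding cyclotomic_class_def by auto
  then show ?thesis using a by (simp add: image_image nat_pow_inv)
qed

lemma card_cls_inv: "a \<in> carrier G \<Longrightarrow> card (cls (inv a)) = card (cls a)"
  unfolding cls_inv by (rule card_image) (use cls_subset inv_inj in \<open>auto intro: inj_on_subset\<close>)

lemma inv_mem_cls: "a \<in> carrier G \<Longrightarrow> b \<in> cls a \<Longrightarrow> inv b \<in> cls (inv a)"
  by (simp add: cls_inv)

lemma cls_disjoint:
  assumes "a \<in> carrier G" "b \<in> carrier G" "cls a \<noteq> cls b"
  shows "cls a \<inter> cls b = {}"
proof (rule ccontr)
  assume "cls a \<inter> cls b \<noteq> {}"
  then obtain x where x: "x \<in> cls a" "x \<in> cls b" by blast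
  show False using cls_eq[OF assms(1) x(1)] cls_eq[OF assms(2) x(2)] assms(3) by simp
qed

lemma cls_inv_eq:
  assumes "a \<in> carrier G" "b \<in> cls a"
  shows "cls (inv b) = cls (inv a)"
  by (rule cls_eq[OF inv_closed[OF assms(1)] inv_mem_cls[OF assms]])

lemma sym_cls_eq:
  assumes a: "a \<in> carrier G" and b: "b \<in> sym_cls a"
  shows "sym_cls b = sym_cls a"
proof -
  consider "b \<in> cls a" | "b \<in> cls (inv a)" using b by (auto simp: sym_cls_def)
  then show ?thesis
  proof cases
    case 1
    show ?thesis unfolding sym_cls_def cls_eq[OF a 1] cls_inv_eq[OF a 1] ..
  next
    case 2
    note ia = inv_closed[OF a]
    show ?thesis unfolding sym_cls_def cls_eq[OF ia 2] cls_inv_eq[OF ia 2] using a by auto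
  qed
qed

lemma sym_cls_subset: "a \<in> carrier G \<Longrightarrow> sym_cls a \<subseteq> carrier G"
  using cls_subset by (simp add: sym_cls_def)

lemma self_in_sym_cls: "a \<in> carrier G \<Longrightarrow> a \<in> sym_cls a"
  using self_in_cls by (simp add: sym_cls_def)

text \<open>Sets of elements rather than of classes, because the class counts are evaluated as sums
  over elements.\<close>

definition "typeI = {a \<in> carrier G. cls a = cls (inv a)}"
definition "typeII = {a \<in> carrier G. cls a \<noteq> cls (inv a)}"

lemma type_partition: "typeI \<union> typeII = carrier G" "typeI \<inter> typeII = {}" "finite typeI" "finite typeII"
  using finG by (auto simp: typeI_def typeII_def)

lemma type_carrier: "a \<in> typeI \<Longrightarrow> a \<in> carrier G" "a \<in> typeII \<Longrightarrow> a \<in> carrier G"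
  by (auto simp: typeI_def typeII_def)

lemma type_classes_eq_image: "type_I_classes G q = cls ` typeI" "type_II_classes G q = cls ` typeII"
  by (auto simp: type_I_classes_def type_II_classes_def typeI_def typeII_def)

lemma cls_subset_type:
  "a \<in> typeI \<Longrightarrow> cls a \<subseteq> typeI" "a \<in> typeII \<Longrightarrow> cls a \<subseteq> typeII"
proof -
  have "cls b = cls a \<and> cls (inv b) = cls (inv a) \<and> b \<in> carrier G"
    if "a \<in> carrier G" "b \<in> cls a" for a b
    using cls_eq[OF that] cls_inv_eq[OF that] cls_subset[OF that(1)] that(2) by auto
  note * = this
  show "cls a \<subseteq> typeI" if "a \<in> typeI"
  proof
    fix b assume "b \<in> cls a"
    then show "b \<in> typeI" using *[of a b] that unfolding typeI_def by auto
  qed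
  show "cls a \<subseteq> typeII" if "a \<in> typeII"
  proof
    fix b assume "b \<in> cls a"
    then show "b \<in> typeII" using *[of a b] that unfolding typeII_def by auto
  qed
qed

lemma inv_type: "a \<in> typeI \<Longrightarrow> inv a \<in> typeI" "a \<in> typeII \<Longrightarrow> inv a \<in> typeII"
  by (auto simp: typeI_def typeII_def)

lemma card_type_I_classes: "real (card (type_I_classes G q)) = (\<Sum>a\<in>typeI. 1 / real (card (cls a)))"
  unfolding type_classes_eq_image
proof (rule card_classes_eq_sum)
  show "cls b = cls a" if "a \<in> typeI" "b \<in> cls a" for a b
    by (rule cls_eq) (use that type_carrier in auto)
qed (use type_partition self_in_cls cls_subset_type type_carrier in auto)

lemma card_type_II_classes: "real (card (type_II_classes G q)) = (\<Sum>a\<in>typeII. 1 / real (card (cls a)))"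
  unfolding type_classes_eq_image
proof (rule card_classes_eq_sum)
  show "cls b = cls a" if "a \<in> typeII" "b \<in> cls a" for a b
    by (rule cls_eq) (use that type_carrier in auto)
qed (use type_partition self_in_cls cls_subset_type type_carrier in auto)

text \<open>For type II the sets S(a) and S(-a) are disjoint and equally large, so symmetrizing
  doubles each class and halves each summand. In particular the number of type II classes is
  even.\<close>

lemma card_type_II_classes_eq: "card (type_II_classes G q) = 2 * card (sym_cls ` typeII)"
proof -
  have "real (card (sym_cls ` typeII)) = (\<Sum>a\<in>typeII. 1 / real (card (sym_cls a)))"
  proof (rule card_classes_eq_sum)
    show "sym_cls b = sym_cls a" if "a \<in> typeII" "b \<in> sym_cls a" for a b
      by (rule sym_cls_eq) (use that type_carrier in auto)
    show "sym_cls a \<subseteq> typeII" if "a \<in> typeII" for a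
      using that cls_subset_type inv_type by (simp add: sym_cls_def)
  qed (use type_partition self_in_sym_cls type_carrier in auto)
  also have "\<dots> = (\<Sum>a\<in>typeII. 1 / real (card (cls a)) / 2)"
  proof (rule sum.cong[OF refl])
    fix a assume a: "a \<in> typeII"
    then have aG: "a \<in> carrier G" by (simp add: typeII_def)
    have "cls a \<inter> cls (inv a) = {}"
      by (rule cls_disjoint) (use a aG in \<open>auto simp: typeII_def\<close>)
    then have "card (sym_cls a) = card (cls a) + card (cls (inv a))"
      unfolding sym_cls_def using aG by (intro card_Un_disjoint finite_cls) auto
    then show "1 / real (card (sym_cls a)) = 1 / real (card (cls a)) / 2"
      by (simp add: card_cls_inv[OF aG])
  qed
  also have "\<dots> = real (card (type_II_classes G q)) / 2"
    unfolding card_type_II_classes by (rule sum_divide_distrib[symmetric])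
  finally show ?thesis by linarith
qed

text \<open>Symmetrizing changes nothing on type I and glues pairs on type II. The two families of
  sets are disjoint, since their members stay inside \<open>typeI\<close> and \<open>typeII\<close>,
  respectively.\<close>

lemma card_sym_cls:
  "card (sym_cls ` carrier G) = card (type_I_classes G q) + card (type_II_classes G q) div 2"
proof -
  have "sym_cls ` carrier G = sym_cls ` typeI \<union> sym_cls ` typeII"
    using type_partition by blast
  moreover have "sym_cls ` typeI \<inter> sym_cls ` typeII = {}"
  proof -
    have "sym_cls a \<subseteq> typeI" if "a \<in> typeI" for a
      using that cls_subset_type inv_type by (simp add: sym_cls_def)
    moreover have "a \<in> sym_cls a" if "a \<in> typeII" for a
      using that self_in_sym_cls by (simp add: typeII_def)
    ultimately show ?thesis using type_partition(2) by blast
  qed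
  moreover have "sym_cls ` typeI = type_I_classes G q"
    unfolding type_classes_eq_image by (rule image_cong) (auto simp: sym_cls_def typeI_def)
  moreover have "finite (sym_cls ` typeI)" "finite (sym_cls ` typeII)" using type_partition by auto
  ultimately have "card (sym_cls ` carrier G) = card (type_I_classes G q) + card (sym_cls ` typeII)"
    using card_Un_disjoint[of "sym_cls ` typeI" "sym_cls ` typeII"] by simp
  then show ?thesis by (simp add: card_type_II_classes_eq)
qed

end


section \<open>Complementary dual codes in semisimple group algebras\<close>

text \<open>Coprimality of \<open>p\<close> and the group order is Maschke's condition; it acts here
  through the invertibility of q modulo that order.\<close>

locale semisimple_group_algebra = finite_group_algebra K G
  for K :: "('a, 'b) ring_scheme" (structure) and G :: "('g, 'h) monoid_scheme" +
  fixes p \<nu> :: nat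
  assumes prime_p: "Factorial_Ring.prime p"
    and finK: "finite (carrier K)" and cardK: "card (carrier K) = p ^ \<nu>"
    and coprime_order: "coprime p (order G)"
begin

abbreviation "q \<equiv> p ^ \<nu>"
text \<open>By Euler's theorem q^t is 1 modulo the group order, so \<open>t\<close> serves as a
  common period for multiplication by q on \<open>G\<close> and for the Frobenius map on
  \<open>KG\<close>.\<close>

abbreviation "t \<equiv> totient (order G)"

lemma q_gt_1: "q > 1"
proof -
  have "card {\<zero>, \<one>} \<le> q" unfolding cardK[symmetric] by (rule card_mono) (use finK in auto)
  then show ?thesis by simp
qed

lemma t_pos: "t > 0"
  using finG G.order_gt_0_iff_finite by simp

lemma pow_period:
  assumes a: "a \<in> carrier G"
  shows "a [^]\<^bsub>G\<^esub> (q ^ t) = a"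
proof -
  have "[q ^ t = 1] (mod order G)"
    by (rule euler_theorem) (use coprime_order in simp)
  moreover have "q ^ t \<ge> 1" using q_gt_1 by simp
  ultimately obtain m where m: "q ^ t = m * order G + 1"
    using cong_le_nat by blast
  show ?thesis
    using a by (simp add: m G.nat_pow_pow[symmetric] mult.commute[of m] G.pow_order_eq_1)
qed

sublocale cyclotomic_classes G q t
  by unfold_locales (use finG t_pos pow_period in auto)

lemma finite_KG: "finite (carrier KG)"
  by (simp add: KG_simps finite_PiE finG finK)

lemma KG_char: "add_pow KG p \<one>\<^bsub>KG\<^esub> = \<zero>\<^bsub>KG\<^esub>"
proof (rule KG_eqI)
  fix g assume g: "g \<in> carrier G"
  have "add_pow K p \<one> = \<zero>" by (rule K.finite_field_char[OF finK cardK])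
  then show "(add_pow KG p \<one>\<^bsub>KG\<^esub>) g = \<zero>\<^bsub>KG\<^esub> g"
    using g by (simp add: KG_add_pow_coeff) (simp add: KG_simps)
qed auto

text \<open>Raising to the power q is additive and fixes the scalars, as K has q elements; only the
  exponents of the monomials move.\<close>

lemma frobenius_eq_finsum:
  assumes u: "u \<in> carrier KG"
  shows "u [^]\<^bsub>KG\<^esub> q = (\<Oplus>\<^bsub>KG\<^esub>a\<in>carrier G. monomial (a [^]\<^bsub>G\<^esub> q) (u a))"
proof -
  have "u [^]\<^bsub>KG\<^esub> q = (\<Oplus>\<^bsub>KG\<^esub>a\<in>carrier G. monomial a (u a)) [^]\<^bsub>KG\<^esub> q"
    using monomial_decomposition[OF u] by simp
  also have "\<dots> = (\<Oplus>\<^bsub>KG\<^esub>a\<in>carrier G. monomial a (u a) [^]\<^bsub>KG\<^esub> q)"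
    by (rule R.freshmans_dream_finsum[OF prime_p KG_char finG]) (use u in auto)
  also have "\<dots> = (\<Oplus>\<^bsub>KG\<^esub>a\<in>carrier G. monomial (a [^]\<^bsub>G\<^esub> q) (u a))"
  proof (rule R.finsum_cong')
    fix a assume a: "a \<in> carrier G"
    have "u a [^] q = u a"
      using K.finite_field_pow_card[OF finK, of "u a"] u a by (simp add: cardK)
    then show "monomial a (u a) [^]\<^bsub>KG\<^esub> q = monomial (a [^]\<^bsub>G\<^esub> q) (u a)"
      using a u by (simp add: monomial_pow)
  qed (use u in auto)
  finally show ?thesis .
qed

text \<open>From q a the element a is recovered by t - 1 further multiplications by q.\<close>

lemma inj_pow_q: "inj_on (\<lambda>a. a [^]\<^bsub>G\<^esub> q) (carrier G)"
proof (rule inj_onI)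
  fix a b assume ab: "a \<in> carrier G" "b \<in> carrier G" "a [^]\<^bsub>G\<^esub> q = b [^]\<^bsub>G\<^esub> q"
  have "x [^]\<^bsub>G\<^esub> (q ^ t) = (x [^]\<^bsub>G\<^esub> q) [^]\<^bsub>G\<^esub> (q ^ (t - 1))" if "x \<in> carrier G" for x
    using that t_pos by (simp add: G.nat_pow_pow power_Suc[symmetric] del: power_Suc)
  then show "a = b" using ab pow_period by metis
qed

lemma frobenius_coeff:
  assumes u: "u \<in> carrier KG" and a: "a \<in> carrier G"
  shows "(u [^]\<^bsub>KG\<^esub> q) (a [^]\<^bsub>G\<^esub> q) = u a"
proof -
  have "(u [^]\<^bsub>KG\<^esub> q) (a [^]\<^bsub>G\<^esub> q) = (\<Oplus>b\<in>carrier G. monomial (b [^]\<^bsub>G\<^esub> q) (u b) (a [^]\<^bsub>G\<^esub> q))"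
    unfolding frobenius_eq_finsum[OF u] by (rule KG_finsum_coeff) (use u a finG in auto)
  also have "\<dots> = (\<Oplus>b\<in>carrier G. if a = b then u b else \<zero>)"
    using u a inj_onD[OF inj_pow_q] by (intro K.finsum_cong') (auto simp: monomial_def)
  also have "\<dots> = u a" by (rule K.finsum_singleton[OF a finG]) (use u in auto)
  finally show ?thesis .
qed

text \<open>This supplies the identity x^m = x, with m = q^t, under which every ideal has an
  idempotent generator.\<close>

lemma frobenius_period:
  assumes u: "u \<in> carrier KG"
  shows "u [^]\<^bsub>KG\<^esub> (q ^ t) = u"
proof (rule KG_eqI)
  fix a assume a: "a \<in> carrier G"
  have "(u [^]\<^bsub>KG\<^esub> (q ^ n)) (a [^]\<^bsub>G\<^esub> (q ^ n)) = u a" for n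
  proof (induction n)
    case (Suc n)
    have "u [^]\<^bsub>KG\<^esub> (q ^ Suc n) = (u [^]\<^bsub>KG\<^esub> (q ^ n)) [^]\<^bsub>KG\<^esub> q"
      using u by (simp add: R.nat_pow_pow mult.commute)
    moreover have "a [^]\<^bsub>G\<^esub> (q ^ Suc n) = (a [^]\<^bsub>G\<^esub> (q ^ n)) [^]\<^bsub>G\<^esub> q"
      using a by (simp add: G.nat_pow_pow mult.commute)
    ultimately show ?case using frobenius_coeff[of "u [^]\<^bsub>KG\<^esub> (q ^ n)" "a [^]\<^bsub>G\<^esub> (q ^ n)"] u a Suc by simp
  qed (use u a in simp)
  then show "(u [^]\<^bsub>KG\<^esub> (q ^ t)) a = u a" using pow_period[OF a] by metis
qed (use u in auto)

lemma frobenius_fixed_iff: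
  assumes u: "u \<in> carrier KG"
  shows "u [^]\<^bsub>KG\<^esub> q = u \<longleftrightarrow> (\<forall>a\<in>carrier G. u (a [^]\<^bsub>G\<^esub> q) = u a)"
proof
  assume "u [^]\<^bsub>KG\<^esub> q = u"
  then show "\<forall>a\<in>carrier G. u (a [^]\<^bsub>G\<^esub> q) = u a" using frobenius_coeff[OF u] by simp
next
  assume inv: "\<forall>a\<in>carrier G. u (a [^]\<^bsub>G\<^esub> q) = u a"
  show "u [^]\<^bsub>KG\<^esub> q = u"
  proof (rule KG_eqI)
    fix g assume g: "g \<in> carrier G"
    \<comment> \<open>Coefficients of the q-th power are known only at points of the form q a;
      injectivity on a finite set makes these all points.\<close>
    have "(\<lambda>a. a [^]\<^bsub>G\<^esub> q) ` carrier G = carrier G"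
      by (rule endo_inj_surj[OF finG _ inj_pow_q]) auto
    then obtain a where a: "a \<in> carrier G" "g = a [^]\<^bsub>G\<^esub> q" using g by auto
    then show "(u [^]\<^bsub>KG\<^esub> q) g = u g" using frobenius_coeff[OF u a(1)] inv by simp
  qed (use u in auto)
qed

text \<open>A restriction of the carrier only, so the operations, the unit and hence the idempotents
  are literally those of \<open>KG\<close>.\<close>

definition fixed_ring :: "('g \<Rightarrow> 'a) ring" where
  "fixed_ring = KG\<lparr>carrier := {u \<in> carrier KG. u [^]\<^bsub>KG\<^esub> q = u \<and> flip u = u}\<rparr>"

lemma fixed_ring_simps [simp]:
  "carrier fixed_ring = {u \<in> carrier KG. u [^]\<^bsub>KG\<^esub> q = u \<and> flip u = u}"
  "\<one>\<^bsub>fixed_ring\<^esub> = \<one>\<^bsub>KG\<^esub>" "\<zero>\<^bsub>fixed_ring\<^esub> = \<zero>\<^bsub>KG\<^esub>"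
  "monoid.mult fixed_ring = monoid.mult KG" "ring.add fixed_ring = ring.add KG"
  by (simp_all add: fixed_ring_def)

lemma fixed_ring_pow: "u [^]\<^bsub>fixed_ring\<^esub> (n::nat) = u [^]\<^bsub>KG\<^esub> n"
  by (induction n) simp_all

lemma fixed_ring_cring: "cring fixed_ring"
proof -
  let ?B = "carrier fixed_ring"
  have pm: "(u \<otimes>\<^bsub>KG\<^esub> v) [^]\<^bsub>KG\<^esub> q = u [^]\<^bsub>KG\<^esub> q \<otimes>\<^bsub>KG\<^esub> v [^]\<^bsub>KG\<^esub> q"
    if "u \<in> carrier KG" "v \<in> carrier KG" for u v
    using that by (rule R.nat_pow_distrib)
  have pa: "(u \<oplus>\<^bsub>KG\<^esub> v) [^]\<^bsub>KG\<^esub> q = u [^]\<^bsub>KG\<^esub> q \<oplus>\<^bsub>KG\<^esub> v [^]\<^bsub>KG\<^esub> q"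
    if "u \<in> carrier KG" "v \<in> carrier KG" for u v
    by (rule R.freshmans_dream_power[OF prime_p KG_char that])
  have zq: "\<zero>\<^bsub>KG\<^esub> [^]\<^bsub>KG\<^esub> q = \<zero>\<^bsub>KG\<^esub>" by (rule R.nat_pow_zero) (use q_gt_1 in linarith)
  \<comment> \<open>Additivity of the Frobenius map shows that (-u)^q + u vanishes, which settles
    the sign without a case distinction on the parity of q.\<close>
  have neg: "\<ominus>\<^bsub>KG\<^esub> u \<in> ?B" if u: "u \<in> ?B" for u
  proof -
    have "(\<ominus>\<^bsub>KG\<^esub> u) [^]\<^bsub>KG\<^esub> q \<oplus>\<^bsub>KG\<^esub> u = ((\<ominus>\<^bsub>KG\<^esub> u) \<oplus>\<^bsub>KG\<^esub> u) [^]\<^bsub>KG\<^esub> q"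
      using u by (subst pa) auto
    also have "\<dots> = \<zero>\<^bsub>KG\<^esub>" using u zq by (simp add: R.l_neg)
    finally have "(\<ominus>\<^bsub>KG\<^esub> u) [^]\<^bsub>KG\<^esub> q = \<ominus>\<^bsub>KG\<^esub> u"
      using u R.minus_equality[of "(\<ominus>\<^bsub>KG\<^esub> u) [^]\<^bsub>KG\<^esub> q" u] by simp
    then show ?thesis using u by (simp add: flip_minus)
  qed
  show ?thesis
  proof (rule cringI)
    show "abelian_group fixed_ring"
    proof (rule abelian_groupI)
      fix x assume x: "x \<in> ?B"
      then show "\<exists>y\<in>?B. y \<oplus>\<^bsub>fixed_ring\<^esub> x = \<zero>\<^bsub>fixed_ring\<^esub>"
        using neg[OF x] by (intro bexI[of _ "\<ominus>\<^bsub>KG\<^esub> x"]) (auto simp: R.l_neg)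
    qed (use pa zq in \<open>auto simp: R.a_ac flip_add\<close>)
    show "comm_monoid fixed_ring"
    proof (rule comm_monoidI)
      show "x \<otimes>\<^bsub>fixed_ring\<^esub> y = y \<otimes>\<^bsub>fixed_ring\<^esub> x" if "x \<in> ?B" "y \<in> ?B" for x y
        using that R.m_comm by simp
    qed (use pm in \<open>auto simp: R.m_assoc flip_mult\<close>)
  qed (auto simp: R.l_distr)
qed

text \<open>Frobenius invariance means constancy along multiplication by q, and flip invariance
  along negation; together they mean constancy on the symmetrized classes.\<close>

lemma card_fixed_ring: "card (carrier fixed_ring) = q ^ card (sym_cls ` carrier G)"
proof -
  have "carrier fixed_ring
      = {u \<in> carrier G \<rightarrow>\<^sub>E carrier K. \<forall>a\<in>carrier G. \<forall>b\<in>sym_cls a. u b = u a}" (is "_ = ?F")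
  proof (intro equalityI subsetI)
    fix u assume "u \<in> carrier fixed_ring"
    then have u: "u \<in> carrier KG" and frob: "\<And>a. a \<in> carrier G \<Longrightarrow> u (a [^]\<^bsub>G\<^esub> q) = u a"
      and flp: "flip u = u" by (auto simp: frobenius_fixed_iff)
    have inv: "u (inv\<^bsub>G\<^esub> a) = u a" if "a \<in> carrier G" for a
      using fun_cong[OF flp, of a] that by (simp add: flip_def)
    have pow: "u (a [^]\<^bsub>G\<^esub> (q ^ i)) = u a" if a: "a \<in> carrier G" for a i
    proof (induction i)
      case (Suc i)
      have "a [^]\<^bsub>G\<^esub> (q ^ Suc i) = (a [^]\<^bsub>G\<^esub> (q ^ i)) [^]\<^bsub>G\<^esub> q"
        using a by (simp add: G.nat_pow_pow mult.commute)
      then show ?case using Suc frob[of "a [^]\<^bsub>G\<^esub> (q ^ i)"] a by simp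
    qed (use a in simp)
    have "u b = u a" if "a \<in> carrier G" "b \<in> sym_cls a" for a b
      using that pow inv by (auto simp: sym_cls_def cyclotomic_class_def)
    then show "u \<in> ?F" using u by (simp add: KG_simps)
  next
    fix u assume uF: "u \<in> ?F"
    then have u: "u \<in> carrier KG" by (simp add: KG_simps)
    have sym: "u b = u a" if "a \<in> carrier G" "b \<in> sym_cls a" for a b using uF that by blast
    have "u (a [^]\<^bsub>G\<^esub> q) = u a" if a: "a \<in> carrier G" for a
      by (rule sym[OF a]) (use cls_pow[OF a self_in_cls[OF a], of 1] in \<open>simp add: sym_cls_def\<close>)
    moreover have "u (inv\<^bsub>G\<^esub> a) = u a" if a: "a \<in> carrier G" for a
      by (rule sym[OF a]) (use self_in_cls[of "inv\<^bsub>G\<^esub> a"] a in \<open>simp add: sym_cls_def\<close>)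
    then have "flip u = u" using u by (intro KG_eqI) (auto simp: flip_def KG_simps(1))
    ultimately show "u \<in> carrier fixed_ring" using u by (simp add: frobenius_fixed_iff)
  qed
  also have "card ?F = card (carrier K) ^ card (sym_cls ` carrier G)"
    by (rule card_class_functions[OF finG self_in_sym_cls sym_cls_subset sym_cls_eq])
  finally show ?thesis by (simp add: cardK)
qed

lemma idempotent_pow:
  assumes "e \<in> carrier KG" "e \<otimes>\<^bsub>KG\<^esub> e = e" "n > 0"
  shows "e [^]\<^bsub>KG\<^esub> (n::nat) = e"
  using assms(3)
proof (induction n)
  case (Suc n)
  then show ?case using assms(1,2) by (cases "n = 0") auto
qed simp

lemma card_flip_fixed_idempotents:
  "card {e \<in> carrier KG. e \<otimes>\<^bsub>KG\<^esub> e = e \<and> flip e = e} = 2 ^ card (sym_cls ` carrier G)"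
proof -
  have "monomial \<one>\<^bsub>G\<^esub> \<in> ring_hom K fixed_ring"
  proof -
    have "monomial \<one>\<^bsub>G\<^esub> c [^]\<^bsub>KG\<^esub> q = monomial \<one>\<^bsub>G\<^esub> c" if "c \<in> carrier K" for c
      using that K.finite_field_pow_card[OF finK that] by (simp add: monomial_pow cardK)
    then show ?thesis using monomial_ring_hom by (auto simp: ring_hom_def)
  qed
  from idempotent_count[OF fixed_ring_cring _ K.field_axioms finK this]
  obtain n where n: "card (carrier fixed_ring) = q ^ n"
    "card {e \<in> carrier fixed_ring. e \<otimes>\<^bsub>KG\<^esub> e = e} = 2 ^ n"
    using finite_KG by (auto simp: fixed_ring_pow cardK)
  \<comment> \<open>The abstract count yields an unnamed exponent; comparing cardinalities
    identifies it, since powers of q > 1 determine their exponents.\<close>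
  have "n = card (sym_cls ` carrier G)"
    using n(1) card_fixed_ring q_gt_1 by (simp add: power_inject_exp)
  moreover have "{e \<in> carrier fixed_ring. e \<otimes>\<^bsub>KG\<^esub> e = e} = {e \<in> carrier KG. e \<otimes>\<^bsub>KG\<^esub> e = e \<and> flip e = e}"
    using idempotent_pow[OF _ _ less_trans[OF zero_less_one q_gt_1]] by auto
  ultimately show ?thesis using n(2) by simp
qed

lemma card_complementary_dual_codes:
  "card {C. abelian_code K G C \<and> euclidean_complementary_dual K G C}
    = 2 ^ (card (type_I_classes G q) + card (type_II_classes G q) div 2)"
proof -
  let ?E = "{e \<in> carrier KG. e \<otimes>\<^bsub>KG\<^esub> e = e \<and> flip e = e}"
  have "inj_on (\<lambda>e. PIdl\<^bsub>KG\<^esub> e) ?E"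
    by (rule inj_onI) (use R.idempotent_generator_unique in auto)
  moreover have "(\<lambda>e. PIdl\<^bsub>KG\<^esub> e) ` ?E = {C. abelian_code K G C \<and> euclidean_complementary_dual K G C}"
  proof (intro equalityI subsetI)
    fix C assume "C \<in> (\<lambda>e. PIdl\<^bsub>KG\<^esub> e) ` ?E"
    then show "C \<in> {C. abelian_code K G C \<and> euclidean_complementary_dual K G C}"
      using R.cgenideal_ideal complementary_dual_iff_flip_fixed by (auto simp: abelian_code_def)
  next
    fix C assume "C \<in> {C. abelian_code K G C \<and> euclidean_complementary_dual K G C}"
    then have C: "ideal C KG" and cd: "euclidean_complementary_dual K G C"
      by (auto simp: abelian_code_def)
    have "q ^ t > 1" using q_gt_1 t_pos by (metis one_less_power)
    from R.ideal_generated_by_idempotent[OF finite_KG frobenius_period this C]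
    obtain e where e: "e \<in> C" "e \<otimes>\<^bsub>KG\<^esub> e = e" "PIdl\<^bsub>KG\<^esub> e = C" by blast
    have "e \<in> carrier KG" using ideal.Icarr[OF C e(1)] .
    then have "e \<in> ?E" using e cd complementary_dual_iff_flip_fixed[of e] by simp
    then show "C \<in> (\<lambda>e. PIdl\<^bsub>KG\<^esub> e) ` ?E" using e(3) by blast
  qed
  ultimately show ?thesis
    using card_image[of "\<lambda>e. PIdl\<^bsub>KG\<^esub> e" ?E] by (simp add: card_flip_fixed_idempotents card_sym_cls)
qed

end


section \<open>The group \<open>(\<int>/2\<^sup>k)\<^sup>s\<close>\<close>

text \<open>For even j the number q^j is an odd square, so q^j + 1 is 2 modulo 4 and i is at most 1.
  For odd j the number q + 1 divides q^j + 1 with an odd cofactor. This removes the quantifier over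
  j from the description of type I.\<close>

lemma two_power_dvd_power_plus_one:
  fixes q i :: nat
  assumes q: "odd q"
  shows "(\<exists>j. 2 ^ i dvd q ^ j + 1) \<longleftrightarrow> 2 ^ i dvd q + 1"
proof
  assume "\<exists>j. 2 ^ i dvd q ^ j + 1"
  then obtain j where j: "2 ^ i dvd q ^ j + 1" by blast
  show "2 ^ i dvd q + 1"
  proof (cases "even j")
    case True
    then obtain l where "j = 2 * l" by blast
    then have "q ^ j = (q ^ l) ^ 2" by (simp add: power_mult mult.commute[of 2])
    moreover have "odd (q ^ l)" using q by simp
    ultimately obtain m where m: "q ^ j = (2 * m + 1) ^ 2" by (metis oddE)
    have "\<not> 4 dvd q ^ j + 1"
    proof
      assume "4 dvd q ^ j + 1"
      moreover have "q ^ j + 1 = 4 * (m * m + m) + 2"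
        by (simp add: m power2_eq_square algebra_simps)
      ultimately have "(4::nat) dvd 2" using dvd_add_right_iff[of 4 "4 * (m * m + m)" 2] by simp
      then show False by simp
    qed
    moreover have "(4::nat) dvd 2 ^ i" if "i \<ge> 2"
      using le_imp_power_dvd[OF that, of "2::nat"] by simp
    ultimately have "i \<le> 1" using j dvd_trans by (metis not_less_eq_eq numeral_2_eq_2 One_nat_def)
    then have "i = 0 \<or> i = 1" by auto
    then show ?thesis using q by auto
  next
    case False
    have "int (q ^ j + 1) = (int q + 1) * (\<Sum>l<j. (- int q) ^ l)"
    proof -
      \<comment> \<open>The geometric sum at -q, taken over the integers because of the alternating
        signs.\<close>
      have "(- int q) ^ j - 1 = (- int q - 1) * (\<Sum>l<j. (- int q) ^ l)"
        by (rule power_diff_1_eq)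
      moreover have "(- int q) ^ j = - (int q ^ j)" using False by (simp add: power_minus_odd)
      ultimately show ?thesis by (simp add: algebra_simps)
    qed
    moreover have odd_sum: "odd (\<Sum>l<j. (- int q) ^ l)"
    proof -
      \<comment> \<open>All terms are odd, so the parity of the sum is that of the number of
        terms.\<close>
      have "even (\<Sum>l<n. (- int q) ^ l) \<longleftrightarrow> even n" for n
        by (induction n) (use q in auto)
      then show ?thesis using False by simp
    qed
    ultimately have "int (2 ^ i) dvd (int q + 1) * (\<Sum>l<j. (- int q) ^ l)"
      using j int_dvd_int_iff by metis
    moreover have "coprime (int (2 ^ i)) (\<Sum>l<j. (- int q) ^ l)"
      using odd_sum by simp
    ultimately have "int (2 ^ i) dvd int q + 1" by (metis coprime_dvd_mult_left_iff)
    then have "int (2 ^ i) dvd int (q + 1)" by (simp add: add.commute)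
    then show ?thesis using int_dvd_int_iff by blast
  qed
next
  assume "2 ^ i dvd q + 1"
  then show "\<exists>j. 2 ^ i dvd q ^ j + 1" by (intro exI[of _ 1]) simp
qed

context cyclotomic_classes
begin

lemma inv_eq_pow_iff:
  assumes a: "a \<in> carrier G"
  shows "a [^] (n::nat) = inv a \<longleftrightarrow> a [^] (n + 1) = \<one>"
  using a inv_equality[of "a [^] n" a] by auto

text \<open>Type I means that -a lies in S(a), that is, q^j + 1 annihilates \<open>a\<close> for
  some j.\<close>

lemma mem_typeI_iff:
  assumes a: "a \<in> carrier G"
  shows "a \<in> typeI \<longleftrightarrow> (\<exists>j. a [^] (q ^ j + 1) = \<one>)"
proof -
  have "a \<in> typeI \<longleftrightarrow> inv a \<in> cls a"
    using a cls_eq[OF a, of "inv a"] self_in_cls[of "inv a"] by (auto simp: typeI_def)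
  also have "\<dots> \<longleftrightarrow> (\<exists>j. a [^] (q ^ j) = inv a)"
    by (auto simp: cyclotomic_class_def eq_commute)
  finally show ?thesis unfolding inv_eq_pow_iff[OF a] .
qed

text \<open>Multiples of \<open>a\<close> depend on the factor modulo the order of \<open>a\<close>,
  so S(a) is as long as the cycle of powers of q modulo that order. Here \<open>ord a\<close> is the
  order in the group, while \<open>Pocklington.ord\<close> is the multiplicative order of an
  integer.\<close>

lemma card_cls:
  assumes a: "a \<in> carrier G" and cop: "coprime (ord a) q"
  shows "card (cls a) = Pocklington.ord (ord a) q"
proof -
  let ?n = "ord a" and ?d = "Pocklington.ord (ord a) q"
  have d: "?d > 0" using cop by simp
  have eq_iff: "a [^] (q ^ i) = a [^] (q ^ j) \<longleftrightarrow> [i = j] (mod ?d)" for i j :: nat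
  proof -
    have "a [^] (q ^ i) = a [^] (q ^ j) \<longleftrightarrow> [q ^ i = q ^ j] (mod ?n)"
      using int_pow_eq[OF a, of "int (q ^ i)" "int (q ^ j)"]
      by (simp add: int_pow_int cong_iff_dvd_diff[symmetric] cong_int_iff[symmetric] cong_sym_eq del: of_nat_power)
    then show ?thesis using order_divides_expdiff[OF cop] by simp
  qed
  have "cls a = (\<lambda>i. a [^] (q ^ i)) ` {..<?d}"
  proof (intro equalityI subsetI)
    fix b assume "b \<in> cls a"
    then obtain i where i: "b = a [^] (q ^ i)" by (auto simp: cyclotomic_class_def)
    have "b = a [^] (q ^ (i mod ?d))" unfolding i eq_iff by (simp add: cong_def)
    then show "b \<in> (\<lambda>i. a [^] (q ^ i)) ` {..<?d}" using d by auto
  qed (auto simp: cyclotomic_class_def)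
  moreover have "inj_on (\<lambda>i. a [^] (q ^ i)) {..<?d}"
    by (rule inj_onI) (auto simp: eq_iff cong_def)
  ultimately show ?thesis by (simp add: card_image)
qed

end

section \<open>Torsion layers and the class counts\<close>

text \<open>The class counts depend only on the exponent and on the sizes of the 2-power torsion
  subgroups, so no coordinates appear here.\<close>

locale homocyclic_two_group = cyclotomic_classes G q t
  for G :: "('g, 'h) monoid_scheme" (structure) and q t +
  fixes k s :: nat
  assumes odd_q: "odd q" and k_pos: "k > 0"
    and exponent: "\<And>a. a \<in> carrier G \<Longrightarrow> a [^] ((2::nat) ^ k) = \<one>"
    and card_torsion: "\<And>j. j \<le> k \<Longrightarrow> card {a \<in> carrier G. a [^] ((2::nat) ^ j) = \<one>} = 2 ^ (j * s)"
begin

definition torsion :: "nat \<Rightarrow> 'g set" where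
  "torsion j = {a \<in> carrier G. a [^] ((2::nat) ^ j) = \<one>}"

lemma torsion_mono: "i \<le> j \<Longrightarrow> torsion i \<subseteq> torsion j"
  using dvd_trans[OF _ le_imp_power_dvd[of i j "2::nat"]] by (auto simp: torsion_def pow_eq_id)

lemma finite_torsion: "finite (torsion j)"
  using finG by (simp add: torsion_def)

lemma card_torsion_diff: "i \<le> j \<Longrightarrow> j \<le> k \<Longrightarrow> card (torsion j - torsion i) = 2 ^ (j * s) - 2 ^ (i * s)"
  using card_Diff_subset[OF finite_torsion torsion_mono, of i j] card_torsion[of i] card_torsion[of j]
  by (simp add: torsion_def)

lemma ord_two_power:
  assumes a: "a \<in> carrier G"
  obtains i where "i \<le> k" "ord a = 2 ^ i"
proof -
  have "ord a dvd 2 ^ k" using exponent[OF a] a by (simp add: pow_eq_id)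
  then show ?thesis using that by (auto simp: divides_primepow_nat)
qed

text \<open>The layers of the torsion filtration are the sets on which the order, and with it the
  class size, is constant.\<close>

lemma ord_torsion_diff:
  assumes a: "a \<in> torsion (Suc i) - torsion i"
  shows "ord a = 2 ^ Suc i"
proof -
  have aG: "a \<in> carrier G" using a by (simp add: torsion_def)
  obtain j where j: "ord a = 2 ^ j" using ord_two_power[OF aG] by blast
  have "ord a dvd 2 ^ Suc i" "\<not> ord a dvd 2 ^ i"
    using a by (simp_all add: torsion_def flip: pow_eq_id[OF aG] del: power_Suc)
  then have "j \<le> Suc i" "\<not> j \<le> i"
    using power_dvd_imp_le[of 2 j "Suc i"] le_imp_power_dvd[of j i "2::nat"] by (auto simp: j)
  then show ?thesis using j by (simp add: le_Suc_eq)
qed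

context
  fixes r :: nat
  assumes r: "r = Max {j. j \<le> k \<and> 2 ^ j dvd q + 1}"
begin

text \<open>Powers of 2 form a chain under divisibility, so their maximum describes them all. The
  bound on i matters: \<open>r\<close> is capped at \<open>k\<close>, while higher powers of 2 may
  still divide q + 1.\<close>

lemma dvd_iff_le_r:
  assumes "i \<le> k"
  shows "2 ^ i dvd q + 1 \<longleftrightarrow> i \<le> r"
proof -
  let ?S = "{j. j \<le> k \<and> 2 ^ j dvd q + 1}"
  have fin: "finite ?S" by (rule finite_subset[of _ "{..k}"]) auto
  have "0 \<in> ?S" by simp
  then have "r \<in> ?S" using Max_in[OF fin] r by blast
  then have "2 ^ i dvd q + 1" if "i \<le> r" using le_imp_power_dvd[OF that, of 2] dvd_trans by blast
  moreover have "i \<le> r" if "2 ^ i dvd q + 1" using Max_ge[OF fin, of i] that assms r by simp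
  ultimately show ?thesis by blast
qed

lemma r_bounds: "1 \<le> r" "r \<le> k"
proof -
  show "1 \<le> r" using dvd_iff_le_r[of 1] k_pos odd_q by simp
  have "finite {j. j \<le> k \<and> 2 ^ j dvd q + 1}" by (rule finite_subset[of _ "{..k}"]) auto
  then show "r \<le> k" unfolding r by (subst Max_le_iff) (auto intro: exI[of _ 0])
qed

text \<open>For an element of order 2^i, being of type I reduces to 2^i dividing q + 1, that is, to
  i being at most \<open>r\<close>.\<close>

lemma typeI_eq_torsion: "typeI = torsion r"
proof -
  have "a \<in> typeI \<longleftrightarrow> a \<in> torsion r" if a: "a \<in> carrier G" for a
  proof -
    obtain i where i: "i \<le> k" "ord a = 2 ^ i" using ord_two_power[OF a] by blast
    have "a \<in> typeI \<longleftrightarrow> i \<le> r"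
      unfolding mem_typeI_iff[OF a] pow_eq_id[OF a] i(2)
      using two_power_dvd_power_plus_one[OF odd_q] dvd_iff_le_r[OF i(1)] by simp
    also have "\<dots> \<longleftrightarrow> a \<in> torsion r"
      using a i by (auto simp: torsion_def pow_eq_id le_imp_power_dvd dest: power_dvd_imp_le)
    finally show ?thesis .
  qed
  then show ?thesis by (auto simp: typeI_def torsion_def)
qed

lemma typeII_eq_torsion: "typeII = torsion k - torsion r"
proof -
  have "torsion k = carrier G" using exponent by (auto simp: torsion_def)
  then show ?thesis using type_partition typeI_eq_torsion by blast
qed

text \<open>The order of \<open>a\<close> divides q + 1, so q acts on \<open>a\<close> as negation
  and S(a) consists of a and -a, which coincide exactly on the 2-torsion.\<close>

lemma card_cls_typeI:
  assumes a: "a \<in> typeI"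
  shows "card (cls a) = (if a \<in> torsion 1 then 1 else 2)"
proof -
  have aG: "a \<in> carrier G" and ar: "a [^] ((2::nat) ^ r) = \<one>"
    using a typeI_eq_torsion by (auto simp: torsion_def)
  have "ord a dvd q + 1"
    using ar dvd_iff_le_r[OF r_bounds(2)] aG dvd_trans by (auto simp: pow_eq_id)
  then have aq: "a [^] q = inv a" unfolding inv_eq_pow_iff[OF aG] pow_eq_id[OF aG] .
  have mem: "a [^] (q ^ j) \<in> {a, inv a}" for j
  proof (induction j)
    case (Suc j)
    have "a [^] (q ^ Suc j) = (a [^] (q ^ j)) [^] q"
      using aG by (simp add: nat_pow_pow mult.commute)
    then show ?case using Suc aq aG by (auto simp: nat_pow_inv)
  qed (use aG in simp)
  have "cls a = {a, inv a}"
  proof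
    show "cls a \<subseteq> {a, inv a}" using mem unfolding cyclotomic_class_def by blast
    show "{a, inv a} \<subseteq> cls a"
      using self_in_cls[OF aG] cls_pow[OF aG self_in_cls[OF aG], of 1] aq by simp
  qed
  moreover have "a = inv a \<longleftrightarrow> a \<in> torsion 1"
    using inv_eq_pow_iff[OF aG, of 1] aG by (simp add: torsion_def numeral_2_eq_2)
  ultimately show ?thesis by auto
qed

text \<open>The first term counts the 2-torsion elements, each a class of its own; the second counts
  the remaining type I elements, which form classes of size two.\<close>

lemma card_type_I_classes_formula:
  "real (card (type_I_classes G q)) = 2 ^ s + (2 ^ (r * s) - 2 ^ s) / 2"
proof -
  have "real (card (type_I_classes G q)) = (\<Sum>a\<in>torsion 1 \<union> (torsion r - torsion 1). 1 / real (card (cls a)))"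
    unfolding card_type_I_classes typeI_eq_torsion
    using torsion_mono[OF r_bounds(1)] by (intro sum.cong) auto
  also have "\<dots> = (\<Sum>a\<in>torsion 1. 1 / real (card (cls a))) + (\<Sum>a\<in>torsion r - torsion 1. 1 / real (card (cls a)))"
    by (rule sum.union_disjoint) (use finite_torsion in auto)
  also have "(\<Sum>a\<in>torsion 1. 1 / real (card (cls a))) = (\<Sum>a\<in>torsion 1. 1)"
    using card_cls_typeI typeI_eq_torsion torsion_mono[OF r_bounds(1)] by (intro sum.cong) auto
  also have "\<dots> = 2 ^ s" using card_torsion[of 1] k_pos by (simp add: torsion_def)
  also have "(\<Sum>a\<in>torsion r - torsion 1. 1 / real (card (cls a))) = (\<Sum>a\<in>torsion r - torsion 1. 1 / 2)"
    using card_cls_typeI typeI_eq_torsion by (intro sum.cong) auto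
  also have "\<dots> = (2 ^ (r * s) - 2 ^ s) / 2"
  proof -
    \<comment> \<open>Ensures that the subtraction of naturals in the size of the layer is not
      truncated when passing to reals.\<close>
    have "(2::nat) ^ s \<le> 2 ^ (r * s)" using r_bounds by (intro power_increasing) auto
    then show ?thesis using card_torsion_diff[OF r_bounds] by (simp add: of_nat_diff)
  qed
  finally show ?thesis .
qed

text \<open>The layer of order 2^i has 2^(is) - 2^((i-1)s) elements, and each lies in a class of
  size ord of q modulo 2^i. The induction adds the layers above \<open>r\<close> one at a time; the
  factor 2 in the denominator comes from pairing the classes.\<close>

lemma card_type_II_classes_formula:
  "real (card (type_II_classes G q)) / 2
    = (\<Sum>i = r + 1..k. (2 ^ (i * s) - 2 ^ ((i - 1) * s)) / (2 * real (Pocklington.ord (2 ^ i) q)))"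
proof -
  let ?f = "\<lambda>a. 1 / real (card (cls a))"
  have "(\<Sum>a\<in>torsion n - torsion r. ?f a)
      = (\<Sum>i = r + 1..n. (2 ^ (i * s) - 2 ^ ((i - 1) * s)) / real (Pocklington.ord (2 ^ i) q))"
    if "r \<le> n" "n \<le> k" for n
    using that
  proof (induction n rule: dec_induct)
    case base
    show ?case by simp
  next
    case (step n)
    have "torsion (Suc n) - torsion r = (torsion n - torsion r) \<union> (torsion (Suc n) - torsion n)"
      using torsion_mono[of n "Suc n"] torsion_mono[OF step.hyps(1)] by auto
    then have "(\<Sum>a\<in>torsion (Suc n) - torsion r. ?f a)
        = (\<Sum>a\<in>torsion n - torsion r. ?f a) + (\<Sum>a\<in>torsion (Suc n) - torsion n. ?f a)"
      by (simp only:) (rule sum.union_disjoint, use finite_torsion in auto)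
    also have "(\<Sum>a\<in>torsion (Suc n) - torsion n. ?f a)
        = (\<Sum>a\<in>torsion (Suc n) - torsion n. 1 / real (Pocklington.ord (2 ^ Suc n) q))"
    proof (rule sum.cong[OF refl])
      fix a assume a: "a \<in> torsion (Suc n) - torsion n"
      then have "card (cls a) = Pocklington.ord (2 ^ Suc n) q"
        using card_cls[of a] ord_torsion_diff[OF a] odd_q by (simp add: torsion_def)
      then show "?f a = 1 / real (Pocklington.ord (2 ^ Suc n) q)" by simp
    qed
    also have "\<dots> = (2 ^ (Suc n * s) - 2 ^ (n * s)) / real (Pocklington.ord (2 ^ Suc n) q)"
    proof -
      have "(2::nat) ^ (n * s) \<le> 2 ^ (Suc n * s)" by (intro power_increasing) auto
      then have "real (card (torsion (Suc n) - torsion n)) = 2 ^ (Suc n * s) - 2 ^ (n * s)"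
        using card_torsion_diff[of n "Suc n"] step.prems by (simp add: of_nat_diff del: mult_Suc)
      then show ?thesis by simp
    qed
    finally show ?case using step by (simp add: step.IH del: mult_Suc)
  qed
  from this[OF r_bounds(2) order_refl] show ?thesis
    unfolding card_type_II_classes typeII_eq_torsion by (simp add: sum_divide_distrib mult.commute)
qed

end

end

section \<open>Torsion in the concrete product group\<close>

lemma int_mod_power_pow:
  assumes "a \<in> carrier (int_mod_power m s)"
  shows "a [^]\<^bsub>int_mod_power m s\<^esub> (n::nat) = (\<lambda>i\<in>{..<s}. (int n * a i) mod int m)"
proof (induction n)
  case 0
  then show ?case by (auto simp: int_mod_power_def)
next
  case (Suc n)
  have "a [^]\<^bsub>int_mod_power m s\<^esub> Suc n
      = (\<lambda>i\<in>{..<s}. (a [^]\<^bsub>int_mod_power m s\<^esub> n) i \<otimes>\<^bsub>integer_mod_group m\<^esub> a i)"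
    by (simp add: int_mod_power_def)
  then show ?case unfolding Suc
    by (auto intro!: restrict_ext simp: mod_simps algebra_simps)
qed

lemma comm_group_int_mod_power: "comm_group (int_mod_power m s)"
proof (rule group.group_comm_groupI)
  show "Group.group (int_mod_power m s)" by (simp add: int_mod_power_def)
  show "x \<otimes>\<^bsub>int_mod_power m s\<^esub> y = y \<otimes>\<^bsub>int_mod_power m s\<^esub> x" for x y
    by (auto simp: int_mod_power_def add.commute)
qed

lemma carrier_int_mod_power:
  "m > 0 \<Longrightarrow> carrier (int_mod_power m s) = {..<s} \<rightarrow>\<^sub>E {0..<int m}"
  by (simp add: int_mod_power_def carrier_integer_mod_group)

text \<open>The solutions of 2^j x = 0 modulo 2^k are the multiples of 2^(k-j), and 2^j of them lie
  below 2^k.\<close>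

lemma card_multiples_of_two_power:
  assumes "j \<le> k"
  shows "card {x \<in> {0..<2 ^ k}. (2 ^ j * x) mod 2 ^ k = (0::int)} = 2 ^ j"
proof -
  have k: "(2::int) ^ k = 2 ^ j * 2 ^ (k - j)" using assms by (simp add: power_add[symmetric])
  have "{x \<in> {0..<2 ^ k}. (2 ^ j * x) mod 2 ^ k = (0::int)} = (\<lambda>y. 2 ^ (k - j) * y) ` {0..<2 ^ j}"
  proof (intro equalityI subsetI)
    fix x :: int assume x: "x \<in> {x \<in> {0..<2 ^ k}. (2 ^ j * x) mod 2 ^ k = 0}"
    then have "2 ^ j * 2 ^ (k - j) dvd 2 ^ j * x" unfolding k by (simp add: dvd_eq_mod_eq_0)
    then have "2 ^ (k - j) dvd x" by simp
    then obtain y where y: "x = 2 ^ (k - j) * y" by blast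
    moreover have "0 \<le> y" using x y by (simp add: zero_le_mult_iff)
    moreover have "2 ^ (k - j) * y < 2 ^ (k - j) * 2 ^ j" using x y k by (simp add: mult.commute)
    then have "y < 2 ^ j" by simp
    ultimately show "x \<in> (\<lambda>y. 2 ^ (k - j) * y) ` {0..<2 ^ j}" by auto
  next
    fix x :: int assume "x \<in> (\<lambda>y. 2 ^ (k - j) * y) ` {0..<2 ^ j}"
    then obtain y where y: "x = 2 ^ (k - j) * y" "0 \<le> y" "y < 2 ^ j" by auto
    have "2 ^ (k - j) * y < 2 ^ (k - j) * 2 ^ j" using y by simp
    then have "x < 2 ^ k" unfolding k y by (simp add: mult.commute)
    moreover have "(2 ^ j * x) mod 2 ^ k = 0"
      unfolding k y by (simp add: mult.assoc[symmetric])
    ultimately show "x \<in> {x \<in> {0..<2 ^ k}. (2 ^ j * x) mod 2 ^ k = 0}" using y by simp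
  qed
  moreover have "inj_on (\<lambda>y. 2 ^ (k - j) * y) {0..<(2::int) ^ j}" by (rule inj_onI) simp
  ultimately show ?thesis by (simp add: card_image nat_power_eq)
qed

text \<open>Torsion is a coordinatewise condition, so the count for one cyclic factor is raised to
  the power \<open>s\<close>.\<close>

lemma card_torsion_int_mod_power:
  assumes "j \<le> k"
  shows "card {a \<in> carrier (int_mod_power (2 ^ k) s). a [^]\<^bsub>int_mod_power (2 ^ k) s\<^esub> ((2::nat) ^ j)
           = \<one>\<^bsub>int_mod_power (2 ^ k) s\<^esub>} = 2 ^ (j * s)"
proof -
  let ?Z = "{x \<in> {0..<2 ^ k}. (2 ^ j * x) mod 2 ^ k = (0::int)}"
  let ?A = "int_mod_power (2 ^ k) s"
  have one: "\<one>\<^bsub>?A\<^esub> = (\<lambda>i\<in>{..<s}. 0)" by (auto simp: int_mod_power_def)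
  have "{a \<in> carrier ?A. a [^]\<^bsub>?A\<^esub> ((2::nat) ^ j) = \<one>\<^bsub>?A\<^esub>} = {..<s} \<rightarrow>\<^sub>E ?Z"
  proof (intro equalityI subsetI)
    fix a assume a: "a \<in> {a \<in> carrier ?A. a [^]\<^bsub>?A\<^esub> ((2::nat) ^ j) = \<one>\<^bsub>?A\<^esub>}"
    then have "(\<lambda>i\<in>{..<s}. (2 ^ j * a i) mod 2 ^ k) = (\<lambda>i\<in>{..<s}. 0)"
      using int_mod_power_pow[of a "2 ^ k" s "2 ^ j"] one by auto
    then have "(2 ^ j * a i) mod 2 ^ k = 0" if "i < s" for i
      using that by (auto dest: fun_cong[of _ _ i])
    then show "a \<in> {..<s} \<rightarrow>\<^sub>E ?Z" using a by (auto simp: carrier_int_mod_power PiE_iff)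
  next
    fix a assume a: "a \<in> {..<s} \<rightarrow>\<^sub>E ?Z"
    then have "a \<in> carrier ?A" by (auto simp: carrier_int_mod_power PiE_iff)
    moreover have "a [^]\<^bsub>?A\<^esub> ((2::nat) ^ j) = \<one>\<^bsub>?A\<^esub>"
      unfolding int_mod_power_pow[OF calculation] one using a by (intro restrict_ext) (auto simp: PiE_iff)
    ultimately show "a \<in> {a \<in> carrier ?A. a [^]\<^bsub>?A\<^esub> ((2::nat) ^ j) = \<one>\<^bsub>?A\<^esub>}" by blast
  qed
  then show ?thesis
    using card_multiples_of_two_power[OF assms] by (simp add: card_PiE power_mult)
qed

lemma homocyclic_two_group_int_mod_power:
  assumes "cyclotomic_classes (int_mod_power (2 ^ k) s) q t" and "odd q" and "k > 0"
  shows "homocyclic_two_group (int_mod_power (2 ^ k) s) q t k s"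
proof (intro homocyclic_two_group.intro homocyclic_two_group_axioms.intro assms)
  let ?A = "int_mod_power (2 ^ k) s"
  show "a [^]\<^bsub>?A\<^esub> ((2::nat) ^ k) = \<one>\<^bsub>?A\<^esub>" if "a \<in> carrier ?A" for a
    unfolding int_mod_power_pow[OF that] by (auto simp: int_mod_power_def intro!: restrict_ext)
qed (rule card_torsion_int_mod_power)

theorem mainTheorem11:
  fixes K :: "('a, 'b) ring_scheme"
    and p \<nu> k s r' r\<^sub>I r\<^sub>I\<^sub>I :: nat
    and A :: "(nat \<Rightarrow> int) monoid"
  assumes "Factorial_Ring.prime p" and "odd p"
    and "\<nu> > 0" and "k > 0" and "s > 0"
    and "field K" and "finite (carrier K)" and "card (carrier K) = p ^ \<nu>"
    and "A = int_mod_power (2 ^ k) s"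
    and "r' = Max {j. j \<le> k \<and> 2 ^ j dvd p ^ \<nu> + 1}"
    and "r\<^sub>I = card (type_I_classes A (p ^ \<nu>))"
    and "r\<^sub>I\<^sub>I = card (type_II_classes A (p ^ \<nu>)) div 2"
  shows "card (type_II_classes A (p ^ \<nu>)) = 2 * r\<^sub>I\<^sub>I
    \<and> real r\<^sub>I = 2 ^ s + (2 ^ (r' * s) - 2 ^ s) / 2
    \<and> real r\<^sub>I\<^sub>I = (\<Sum>i = r' + 1..k. (2 ^ (i * s) - 2 ^ ((i - 1) * s)) / (2 * real (ord (2 ^ i) (p ^ \<nu>))))
    \<and> card {C. abelian_code K A C \<and> euclidean_complementary_dual K A C} = 2 ^ (r\<^sub>I + r\<^sub>I\<^sub>I)"
proof -
  note A = \<open>A = int_mod_power (2 ^ k) s\<close>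
  have card_A: "card (carrier A) = 2 ^ (k * s)"
    by (simp add: A carrier_int_mod_power card_PiE power_mult nat_power_eq)
  have "finite_group_algebra K A"
    using \<open>field K\<close> comm_group_int_mod_power card_A
    by (intro finite_group_algebra.intro finite_group_algebra_axioms.intro)
       (auto simp: A intro: card_ge_0_finite)
  \<comment> \<open>An odd \<open>p\<close> is coprime to the group order, which is a power of
    2.\<close>
  then interpret semisimple_group_algebra K A p \<nu>
    using assms(1,2,7,8) card_A
    by (intro semisimple_group_algebra.intro semisimple_group_algebra_axioms.intro)
       (auto simp: order_def)
  have "homocyclic_two_group A (p ^ \<nu>) t k s"
    unfolding A by (rule homocyclic_two_group_int_mod_power)
      (use cyclotomic_classes_axioms \<open>odd p\<close> \<open>k > 0\<close> in \<open>auto simp: A\<close>)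
  then interpret homocyclic_two_group A "p ^ \<nu>" t k s .
  \<comment> \<open>With the parity known, the \<open>div 2\<close> in the hypothesis is exact and
    agrees with the real quotient in the type II formula.\<close>
  have even: "card (type_II_classes A (p ^ \<nu>)) = 2 * r\<^sub>I\<^sub>I"
    using card_type_II_classes_eq assms(12) by simp
  then show ?thesis
    using card_type_I_classes_formula[OF assms(10)] card_type_II_classes_formula[OF assms(10)]
      card_complementary_dual_codes assms(11,12)
    by simp
qed

end
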